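(* For all positive integers $n,p$, $$\beta(n,p,4)=O\left(n^{3/4}p^{1/2}+n^{5/8}p^{11/16}+n+p\right).$$
   Context: A path system is a pair $S=(V,\Pi)$ where $V$ is a finite ground set of nodes and $\Pi$ is a multiset of finite sequences of nodes (paths), each path containing each node at most once. The size is $\|S\|=\sum_{\pi\in\Pi}|\pi|$, where $|\pi|$ is the number of nodes of $\pi$. Write $x<_\pi y$ if $x,y\in\pi$ and $x$ strictly precedes $y$ in $\pi$. A $b$-bridge consists of $b$ distinct nodes $v_1,\dots,v_b$ and $b$ distinct paths $\pi_1,\dots,\pi_b$ with $v_i<_{\pi_i}v_{i+1}$ for $1\le i\le b-1$ and $v_1<_{\pi_b}v_b$. The bridge girth of $S$ is the least $b$ for which $S$ has a $b$-bridge ($\infty$ if none). $\beta(n,p,k)$ is the maximum possible size of a path system with $n$ nodes, $p$ paths, and bridge girth $>k$. *)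

theory Defs
  imports Complex_Main "HOL-Library.Extended_Nat"
begin

text \<open>A path system: ground set V and a finite family of paths, given as a list
  (list positions distinguish repeated copies, so the list represents the multiset \<Pi>).
  Each path is a list of nodes of V without repetitions.\<close>
definition path_system :: "'a set \<Rightarrow> 'a list list \<Rightarrow> bool" where
  "path_system V Ps \<longleftrightarrow> finite V \<and> (\<forall>\<pi>\<in>set Ps. distinct \<pi> \<and> set \<pi> \<subseteq> V)"

definition ps_size :: "'a list list \<Rightarrow> nat" where
  "ps_size Ps = (\<Sum>\<pi>\<leftarrow>Ps. length \<pi>)"

definition precedes :: "'a list \<Rightarrow> 'a \<Rightarrow> 'a \<Rightarrow> bool" where
  "precedes \<pi> x y \<longleftrightarrow> (\<exists>i j. i < j \<and> j < length \<pi> \<and> \<pi> ! i = x \<and> \<pi> ! j = y)"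

definition has_bridge :: "'a list list \<Rightarrow> nat \<Rightarrow> bool" where
  "has_bridge Ps b \<longleftrightarrow> b \<ge> 1 \<and> (\<exists>(v::nat \<Rightarrow> 'a) (f::nat \<Rightarrow> nat).
      inj_on v {0..<b} \<and> inj_on f {0..<b} \<and> (\<forall>i<b. f i < length Ps) \<and>
      (\<forall>i. i + 1 < b \<longrightarrow> precedes (Ps ! f i) (v i) (v (i+1))) \<and>
      precedes (Ps ! f (b - 1)) (v 0) (v (b - 1)))"

definition bridge_girth :: "'a list list \<Rightarrow> enat" where
  "bridge_girth Ps = (if \<exists>b. has_bridge Ps b then enat (LEAST b. has_bridge Ps b) else \<infinity>)"

text \<open>beta n p k: maximum size of a path system with n nodes, p paths and bridge girth > k
  (nodes taken from nat w.l.o.g.; the set of sizes is finite, bounded by n*p).\<close>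
definition beta :: "nat \<Rightarrow> nat \<Rightarrow> nat \<Rightarrow> nat" where
  "beta n p k = Max {ps_size Ps | (V::nat set) Ps. path_system V Ps \<and> card V = n \<and>
       length Ps = p \<and> bridge_girth Ps > enat k}"

end

theory Submission
  imports Defs "HOL-Analysis.Convex"
begin

text \<open>
  Let \<open>d\<close> and \<open>\<ell>\<close> be the average degree and path length. For two paths \<open>P\<close>, \<open>Q\<close>, the paths leading from
  \<open>P\<close> to \<open>Q\<close> (rungs) hit \<open>P\<close> and \<open>Q\<close> in the same order, since two crossing rungs form a 4-bridge with
  \<open>P\<close> and \<open>Q\<close>. Hence nearby rungs of length about \<open>\<ell>\<close> span many thin diamonds: a walk (short step, long
  step) and a walk (long step, short step) with the same ends \<open>(u, v)\<close>. By Cauchy-Schwarz there are then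
  many pairs of (short, long) walks with common ends, or many pairs of (long, short) ones. Two such
  walks are again rungs of a ladder, now with two ends close together on one path and the other two far
  apart on the other, and monotonicity of ladders allows only few of these. Comparing both counts gives
  \<open>size\<^sup>4 = O(n\<^sup>3p\<^sup>2)\<close> or \<open>size\<^sup>1\<^sup>0 = O(n\<^sup>6p\<^sup>7)\<close> unless \<open>size = O(n + p)\<close>.

  Two paths may meet repeatedly, in opposite orders. After halving every path, 4-bridges bound the
  number of such multiple crossings by a constant per node of a path on average, so single crossings
  dominate.
\<close>

section \<open>Counting\<close>

definition fibre_product :: "('a \<Rightarrow> 'c) \<Rightarrow> 'a set \<Rightarrow> ('b \<Rightarrow> 'c) \<Rightarrow> 'b set \<Rightarrow> ('a \<times> 'b) set" where
  "fibre_product f A g B = {(x, y) \<in> A \<times> B. f x = g y}"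

lemma finite_fibre_product: "finite A \<Longrightarrow> finite B \<Longrightarrow> finite (fibre_product f A g B)"
  by (rule finite_subset[of _ "A \<times> B"]) (auto simp: fibre_product_def)

lemma card_fibre_product:
  assumes "finite A" "finite B" "finite T" "f ` A \<subseteq> T"
  shows "card (fibre_product f A g B) = (\<Sum>t\<in>T. card {x\<in>A. f x = t} * card {y\<in>B. g y = t})"
proof -
  have "fibre_product f A g B = (\<Union>t\<in>T. {x\<in>A. f x = t} \<times> {y\<in>B. g y = t})"
    using assms by (auto simp: fibre_product_def)
  moreover have "card \<dots> = (\<Sum>t\<in>T. card ({x\<in>A. f x = t} \<times> {y\<in>B. g y = t}))"
    using assms by (intro card_UN_disjoint) auto
  ultimately show ?thesis
    by (simp add: card_cartesian_product)
qed

lemma card_squared_le_fibre_product: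
  assumes "finite A" "finite T" "f ` A \<subseteq> T"
  shows "(card A)\<^sup>2 \<le> card T * card (fibre_product f A f A)"
proof -
  let ?c = "\<lambda>t. card {x\<in>A. f x = t}"
  have "card A = (\<Sum>t\<in>T. ?c t)"
    using sum.group[OF assms, of "\<lambda>_. 1::nat"] by simp
  then have "(real (card A))\<^sup>2 = (\<Sum>t\<in>T. real (?c t))\<^sup>2"
    by simp
  also have "\<dots> \<le> (\<Sum>t\<in>T. (real (?c t))\<^sup>2) * card T"
    using sum_squared_le_sum_of_squares by blast
  also have "\<dots> = real (card T * card (fibre_product f A f A))"
    by (subst card_fibre_product[OF assms(1,1,2,3)]) (simp add: power2_eq_square mult.commute)
  finally show ?thesis
    by (simp only: of_nat_power[symmetric] of_nat_le_iff)
qed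

lemma card_mixed_fibre_product_le:
  assumes "finite A" "finite B"
  shows "2 * card (fibre_product f A g B) \<le> card (fibre_product f A f A) + card (fibre_product g B g B)"
proof -
  let ?T = "f ` A \<union> g ` B"
  have amgm: "2 * (a * b) \<le> a * a + b * b" for a b :: nat
  proof -
    have "real (2 * (a * b)) \<le> real (a * a + b * b)"
      using sum_squares_bound[of "real a" "real b"] by (simp add: power2_eq_square)
    then show ?thesis by (simp only: of_nat_le_iff)
  qed
  have T: "finite ?T" "f ` A \<subseteq> ?T" "g ` B \<subseteq> ?T"
    using assms by auto
  show ?thesis
    unfolding card_fibre_product[OF assms T(1,2)] card_fibre_product[OF assms(1,1) T(1,2)]
      card_fibre_product[OF assms(2,2) T(1,3)] sum_distrib_left sum.distrib[symmetric]
    by (intro sum_mono amgm)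
qed

lemma card_self_fibre_product_le:
  assumes fin: "finite A"
    and total: "\<And>x y. \<lbrakk>x \<in> A; y \<in> A; f x = f y; x \<noteq> y\<rbrakk> \<Longrightarrow> R x y \<or> R y x"
  shows "card (fibre_product f A f A) \<le> card A + 2 * card {(x, y) \<in> fibre_product f A f A. R x y}"
proof -
  let ?D = "(\<lambda>x. (x, x)) ` A" and ?Q = "{(x, y) \<in> fibre_product f A f A. R x y}"
  have finQ: "finite ?Q"
    by (rule finite_subset[OF _ finite_fibre_product[OF fin fin]]) auto
  have "q \<in> ?D \<union> ?Q \<union> prod.swap ` ?Q" if q: "q \<in> fibre_product f A f A" for q
  proof -
    obtain x y where xy: "q = (x, y)" "x \<in> A" "y \<in> A" "f x = f y"
      using q by (auto simp: fibre_product_def)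
    then consider "x = y" | "R x y" | "R y x"
      using total by blast
    then show ?thesis
    proof cases
      case 3
      then have "(y, x) \<in> ?Q"
        using xy by (simp add: fibre_product_def)
      then have "prod.swap (y, x) \<in> prod.swap ` ?Q"
        by (rule imageI)
      then show ?thesis
        using xy by simp
    qed (use xy q in auto)
  qed
  then have "card (fibre_product f A f A) \<le> card (?D \<union> ?Q \<union> prod.swap ` ?Q)"
    using fin finQ by (intro card_mono) auto
  also have "\<dots> \<le> card ?D + card ?Q + card (prod.swap ` ?Q)"
    by (rule order.trans[OF card_Un_le add_mono[OF card_Un_le order.refl]])
  also have "\<dots> \<le> card A + 2 * card ?Q"
    using card_image_le[OF fin, of "\<lambda>x. (x, x)"] card_image_le[OF finQ, of prod.swap] by linarith
  finally show ?thesis .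
qed

lemma card_Sigma_le:
  assumes "finite A" "\<And>x. x \<in> A \<Longrightarrow> finite (B x)" "\<And>x. x \<in> A \<Longrightarrow> card (B x) \<le> c"
  shows "card (Sigma A B) \<le> card A * c"
  using assms sum_bounded_above[of A "\<lambda>x. card (B x)" c] by simp

lemma finite_card_iterated_Sigma_le:
  assumes "finite A" "card A \<le> a"
    and B: "\<And>x. x \<in> A \<Longrightarrow> finite (B x) \<and> card (B x) \<le> b"
    and C: "\<And>x y. x \<in> A \<Longrightarrow> y \<in> B x \<Longrightarrow> finite (C x y) \<and> card (C x y) \<le> c"
  shows "finite (SIGMA x:A. SIGMA y:B x. C x y) \<and> card (SIGMA x:A. SIGMA y:B x. C x y) \<le> a * (b * c)"
proof -
  have "card (SIGMA y:B x. C x y) \<le> b * c" if "x \<in> A" for x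
    using card_Sigma_le[of "B x" "C x" c] B[OF that] C[OF that] mult_le_mono1 le_trans by meson
  then have "card (SIGMA x:A. SIGMA y:B x. C x y) \<le> card A * (b * c)"
    using assms by (intro card_Sigma_le) auto
  also have "\<dots> \<le> a * (b * c)"
    using assms(2) by (rule mult_le_mono1)
  finally show ?thesis
    using assms by auto
qed

lemma exists_balanced_partition:
  fixes d :: nat
  assumes "finite S" "0 < d" "d \<le> card S"
  shows "\<exists>f::'b \<Rightarrow> nat. \<forall>x\<in>S. card {y\<in>S. f y = f x} \<in> {d..2 * d}"
  using assms
proof (induction "card S" arbitrary: S rule: less_induct)
  case less
  show ?case
  proof (cases "card S \<le> 2 * d")
    case True
    then show ?thesis
      using less.prems by (intro exI[of _ "\<lambda>_. 0"]) auto
  next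
    case False
    obtain D where D: "D \<subseteq> S" "card D = d" "finite D"
      using less.prems by (meson obtain_subset_with_card_n)
    then have "card (S - D) = card S - d"
      by (simp add: card_Diff_subset)
    then have "card (S - D) < card S" "finite (S - D)" "d \<le> card (S - D)"
      using less.prems False by auto
    then obtain f :: "'b \<Rightarrow> nat" where f: "\<forall>x\<in>S-D. card {y\<in>S-D. f y = f x} \<in> {d..2 * d}"
      using less.hyps[of "S - D"] less.prems by blast
    define h where "h = (\<lambda>y. if y \<in> D then 0 else Suc (f y))"
    have "{y\<in>S. h y = h x} = D" if "x \<in> D" for x
      using that D by (auto simp: h_def)
    moreover have "{y\<in>S. h y = h x} = {y\<in>S-D. f y = f x}" if "x \<in> S - D" for x
      using that D by (auto simp: h_def)
    ultimately have "card {y\<in>S. h y = h x} \<in> {d..2 * d}" if "x \<in> S" for x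
      using f D(2) that by (cases "x \<in> D") auto
    then show ?thesis by blast
  qed
qed

lemma exists_dense_subgraph:
  fixes E :: "'i \<Rightarrow> 'a \<Rightarrow> bool" and \<delta> m :: nat
  assumes "finite I" "finite V" "card V * \<delta> + card I * m < (\<Sum>i\<in>I. card {x\<in>V. E i x})"
  shows "\<exists>J\<subseteq>I. \<exists>W\<subseteq>V. J \<noteq> {} \<and> (\<forall>i\<in>J. m \<le> card {x\<in>W. E i x}) \<and> (\<forall>x\<in>W. \<delta> \<le> card {i\<in>J. E i x})"
  using assms
proof (induction "card I + card V" arbitrary: I V rule: less_induct)
  case less
  note fin = less.prems(1,2) and large = less.prems(3)
  have IH: ?case if "J \<subseteq> I" "W \<subseteq> V" "card J + card W < card I + card V"
    "card W * \<delta> + card J * m < (\<Sum>i\<in>J. card {x\<in>W. E i x})" for J W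
    using less.hyps[OF that(3) _ _ that(4)] that(1,2) fin finite_subset by (meson subset_trans)
  consider i where "i \<in> I" "card {x\<in>V. E i x} < m" | x where "x \<in> V" "card {i\<in>I. E i x} < \<delta>"
    | "\<forall>i\<in>I. m \<le> card {x\<in>V. E i x}" "\<forall>x\<in>V. \<delta> \<le> card {i\<in>I. E i x}"
    by (meson not_le)
  then show ?case
  proof cases
    case 1
    have "card V * \<delta> + card (I - {i}) * m < (\<Sum>i\<in>I - {i}. card {x\<in>V. E i x})"
      using large 1(2) card.remove[OF fin(1) 1(1)]
        sum.remove[OF fin(1) 1(1), of "\<lambda>i. card {x\<in>V. E i x}"] by simp
    then show ?thesis
      using card_Diff1_less[OF fin(1) 1(1)] by (intro IH[of "I - {i}" V]) auto
  next
    case 2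
    have swap: "(\<Sum>i\<in>I. card {x\<in>W. E i x}) = (\<Sum>x\<in>W. card {i\<in>I. E i x})" if "W \<subseteq> V" for W
      using that fin finite_subset by (intro sum_multicount_gen) auto
    have "card (V - {x}) * \<delta> + card I * m < (\<Sum>x\<in>V - {x}. card {i\<in>I. E i x})"
      using large[unfolded swap[OF order.refl]] 2(2) card.remove[OF fin(2) 2(1)]
        sum.remove[OF fin(2) 2(1), of "\<lambda>x. card {i\<in>I. E i x}"] by simp
    then show ?thesis
      using card_Diff1_less[OF fin(2) 2(1)] swap[of "V - {x}"] by (intro IH[of I "V - {x}"]) auto
  next
    case 3
    moreover have "I \<noteq> {}"
      using large by auto
    ultimately show ?thesis by blast
  qed
qed

lemma card_shift_inter_ge:
  fixes A :: "nat set"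
  assumes "A \<subseteq> {..<n}"
  shows "2 * card A \<le> n + c + card {m\<in>A. m + c \<in> A}"
proof -
  let ?shift = "\<lambda>m. m + c"
  have fin: "finite A"
    using assms finite_subset by blast
  have "A \<inter> ?shift ` A = ?shift ` {m\<in>A. m + c \<in> A}"
    by auto
  then have "card (A \<inter> ?shift ` A) = card {m\<in>A. m + c \<in> A}"
    by (simp add: card_image)
  moreover have "card A + card (?shift ` A) = card (A \<union> ?shift ` A) + card (A \<inter> ?shift ` A)"
    using fin by (intro card_Un_Int) auto
  moreover have "card (?shift ` A) = card A"
    by (simp add: card_image)
  moreover have "card (A \<union> ?shift ` A) \<le> card {..<n + c}"
    using assms by (intro card_mono) auto
  ultimately show ?thesis
    by simp
qed

lemma card_gap_pairs_ge:
  fixes n L :: nat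
  assumes A: "A \<subseteq> {..<n}" "7 * n \<le> 8 * card A" and L: "4 * L \<le> n"
  shows "L * n \<le> 4 * card {(m, m') \<in> A \<times> A. m + L \<le> m' \<and> m' < m + 2 * L}" (is "_ \<le> 4 * card ?G")
proof -
  define shifts where "shifts c = {m\<in>A. m + c \<in> A}" for c
  have fin: "finite A" "finite (shifts c)" for c
    using finite_subset[OF A(1)] by (auto simp: shifts_def)
  have shifts_ge: "n \<le> 4 * card (shifts c)" if "c \<in> {L..<2 * L}" for c
  proof -
    have "c < 2 * L"
      using that by simp
    then show ?thesis
      using card_shift_inter_ge[OF A(1), of c] A(2) L unfolding shifts_def by linarith
  qed
  have "card (SIGMA c:{L..<2 * L}. shifts c) \<le> card ?G"
  proof (rule card_inj_on_le[of "\<lambda>(c, m). (m, m + c)"])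
    show "finite ?G"
      by (rule finite_subset[of _ "A \<times> A"]) (use fin in auto)
  qed (auto simp: inj_on_def shifts_def)
  then have "(\<Sum>c\<in>{L..<2 * L}. card (shifts c)) \<le> card ?G"
    using fin by simp
  moreover have "(\<Sum>c\<in>{L..<2 * L}. n) \<le> (\<Sum>c\<in>{L..<2 * L}. 4 * card (shifts c))"
    by (intro sum_mono shifts_ge)
  ultimately show ?thesis
    by (simp add: sum_distrib_left[symmetric])
qed

definition skew_pairs :: "('c \<Rightarrow> nat) \<Rightarrow> ('c \<Rightarrow> nat) \<Rightarrow> nat \<Rightarrow> nat \<Rightarrow> 'c set \<Rightarrow> ('c \<times> 'c) set" where
  "skew_pairs f g s L C = {(c, c') \<in> C \<times> C. f c < f c' \<and> f c div s = f c' div s \<and> g c + L \<le> g c'}"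

lemma multiple_between_skew_pair:
  assumes "(c, c') \<in> skew_pairs f g s L C" "0 < L"
  shows "g c < g c' div L * L" "g c' div L * L \<le> g c'"
proof -
  have "g c' < g c' div L * L + L"
    using assms(2) by (metis add.commute dividend_less_div_times)
  then show "g c < g c' div L * L"
    using assms(1) by (auto simp: skew_pairs_def)
qed auto

lemma skew_pairs_cell_le:
  assumes mono: "\<And>c c'. c \<in> C \<Longrightarrow> c' \<in> C \<Longrightarrow> f c < f c' \<longleftrightarrow> g c < g c'"
    and pairs: "(c, c') \<in> skew_pairs f g s L C" "(e, e') \<in> skew_pairs f g s L C"
    and same_multiple: "g c' div L = g e' div L" and "0 < L"
  shows "f e div s \<le> f c div s"
proof (rule ccontr)
  assume "\<not> f e div s \<le> f c div s"
  then have "f c' < f e"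
    using pairs(1) div_le_mono[of "f e" "f c'" s] by (fastforce simp: skew_pairs_def)
  then have "g c' < g e"
    using mono[of c' e] pairs by (auto simp: skew_pairs_def)
  then show False
    using multiple_between_skew_pair[OF pairs(1) \<open>0 < L\<close>]
      multiple_between_skew_pair[OF pairs(2) \<open>0 < L\<close>] same_multiple by simp
qed

text \<open>By the previous lemma, each multiple of \<open>L\<close> separates \<open>g c\<close> from \<open>g c'\<close> only for pairs in a
  single cell of length \<open>s\<close>.\<close>

lemma card_skew_pairs_le:
  assumes mono: "\<And>c c'. c \<in> C \<Longrightarrow> c' \<in> C \<Longrightarrow> f c < f c' \<longleftrightarrow> g c < g c'" and inj: "inj_on f C"
    and bound: "\<And>c. c \<in> C \<Longrightarrow> g c < m" and "0 < s" "0 < L"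
  shows "L * card (skew_pairs f g s L C) \<le> s\<^sup>2 * m"
proof -
  let ?Z = "skew_pairs f g s L C"
  define code where "code = (\<lambda>(c, c'). (g c' div L, f c mod s, f c' mod s))"
  have "inj_on code ?Z"
  proof (rule inj_onI, clarify)
    fix c c' e e' assume z: "(c, c') \<in> ?Z" "(e, e') \<in> ?Z" "code (c, c') = code (e, e')"
    have code: "g c' div L = g e' div L" "f c mod s = f e mod s" "f c' mod s = f e' mod s"
      using z(3) by (auto simp: code_def)
    have cell: "f c div s = f e div s"
      using skew_pairs_cell_le[OF mono z(1,2) code(1) \<open>0 < L\<close>]
        skew_pairs_cell_le[OF mono z(2,1) code(1)[symmetric] \<open>0 < L\<close>] by simp
    then have "f c' div s = f e' div s"
      using z(1,2) by (auto simp: skew_pairs_def)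
    then have "f c = f e" "f c' = f e'"
      using cell code(2,3) by (metis div_mult_mod_eq)+
    then show "c = e \<and> c' = e'"
      using z(1,2) inj_onD[OF inj] by (auto simp: skew_pairs_def)
  qed
  moreover have "code ` ?Z \<subseteq> {1..m div L} \<times> {..<s} \<times> {..<s}"
  proof (rule image_subsetI)
    fix z assume "z \<in> ?Z"
    then obtain c c' where "z = (c, c')" "g c' < m" "L \<le> g c'"
      using bound by (auto simp: skew_pairs_def)
    then show "code z \<in> {1..m div L} \<times> {..<s} \<times> {..<s}"
      using \<open>0 < s\<close> \<open>0 < L\<close> by (auto simp: code_def div_le_mono div_greater_zero_iff Suc_le_eq)
  qed
  ultimately have "card ?Z \<le> card ({1..m div L} \<times> {..<s} \<times> {..<s})"
    by (rule card_inj_on_le) simp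
  then have "L * card ?Z \<le> s\<^sup>2 * (L * (m div L))"
    using mult_le_mono2[of "card ?Z" _ L] by (simp add: power2_eq_square mult_ac)
  also have "\<dots> \<le> s\<^sup>2 * m"
    by (intro mult_le_mono2) simp
  finally show ?thesis .
qed

section \<open>Positions on a path\<close>

definition position :: "'a list \<Rightarrow> 'a \<Rightarrow> nat" where
  "position xs x = length (takeWhile (\<lambda>y. y \<noteq> x) xs)"

lemma position_less: "x \<in> set xs \<Longrightarrow> position xs x < length xs"
  by (induction xs) (auto simp: position_def)

lemma nth_position: "x \<in> set xs \<Longrightarrow> xs ! position xs x = x"
  by (induction xs) (auto simp: position_def)

lemma position_nth: "distinct xs \<Longrightarrow> k < length xs \<Longrightarrow> position xs (xs ! k) = k"
  by (meson nth_eq_iff_index_eq nth_mem nth_position position_less)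

lemma inj_on_position: "inj_on (position xs) (set xs)"
  by (metis inj_onI nth_position)

lemma card_le_position_window:
  assumes "A \<subseteq> set xs" "position xs ` A \<subseteq> {m..<m + c}"
  shows "card A \<le> c"
  using card_inj_on_le[OF inj_on_subset[OF inj_on_position assms(1)] assms(2)] by simp

lemma precedes_iff_position:
  assumes "distinct xs"
  shows "precedes xs x y \<longleftrightarrow> x \<in> set xs \<and> y \<in> set xs \<and> position xs x < position xs y"
proof
  assume "precedes xs x y"
  then obtain i j where "i < j" "j < length xs" "xs ! i = x" "xs ! j = y"
    by (auto simp: precedes_def)
  then show "x \<in> set xs \<and> y \<in> set xs \<and> position xs x < position xs y"
    using position_nth[OF assms] by auto
next
  assume "x \<in> set xs \<and> y \<in> set xs \<and> position xs x < position xs y"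
  then show "precedes xs x y"
    using nth_position position_less unfolding precedes_def by metis
qed

lemma precedes_Cons: "precedes (a # xs) x y \<longleftrightarrow> a = x \<and> y \<in> set xs \<or> precedes xs x y"
proof
  assume "precedes (a # xs) x y"
  then obtain i j where "i < j" "j < Suc (length xs)" "(a # xs) ! i = x" "(a # xs) ! j = y"
    by (auto simp: precedes_def)
  then show "a = x \<and> y \<in> set xs \<or> precedes xs x y"
    by (cases i; cases j) (auto simp: precedes_def)
next
  assume "a = x \<and> y \<in> set xs \<or> precedes xs x y"
  then show "precedes (a # xs) x y"
    by (metis in_set_conv_nth length_Cons nth_Cons_0 nth_Cons_Suc precedes_def Suc_less_eq
        zero_less_Suc)
qed

lemma precedes_filterD: "precedes (filter Q xs) x y \<Longrightarrow> precedes xs x y"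
  by (induction xs) (auto simp: precedes_Cons split: if_splits)

lemma card_nonsingleton_le:
  assumes "distinct xs" "B \<subseteq> set xs"
  shows "card {x\<in>B. B \<noteq> {x}} \<le> 2 * card {x\<in>B. \<exists>y\<in>B. precedes xs y x}"
proof (cases "card B \<le> 1")
  case True
  then have none: "{x\<in>B. B \<noteq> {x}} = {}"
    using assms finite_subset[of B "set xs"] card_le_Suc0_iff_eq[of B] by auto
  show ?thesis
    unfolding none by simp
next
  case False
  have fin: "finite B"
    using assms(2) finite_subset by blast
  have "B \<noteq> {}"
    using False by auto
  then obtain m where m: "m \<in> B" "\<forall>x. x \<in> B \<longrightarrow> position xs m \<le> position xs x"
    using ex_has_least_nat[of "\<lambda>x. x \<in> B"] by blast
  have "precedes xs m x" if "x \<in> B - {m}" for x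
    using that m assms(2) inj_onD[OF inj_on_position, of xs m x]
    unfolding precedes_iff_position[OF assms(1)] by (metis Diff_iff in_mono nat_less_le singletonI)
  then have "B - {m} \<subseteq> {x\<in>B. \<exists>y\<in>B. precedes xs y x}"
    using m(1) by blast
  then have "card B - 1 \<le> card {x\<in>B. \<exists>y\<in>B. precedes xs y x}"
    using card_mono[of "{x\<in>B. \<exists>y\<in>B. precedes xs y x}" "B - {m}"] fin m(1) by simp
  moreover have "card {x\<in>B. B \<noteq> {x}} \<le> card B"
    using fin by (intro card_mono) auto
  ultimately show ?thesis
    using False by linarith
qed

section \<open>Families of paths without short bridges\<close>

locale bridge_free_family =
  fixes I :: "'i set" and P :: "'i \<Rightarrow> 'a list"
  assumes finite_I: "finite I"
    and distinct_path: "i \<in> I \<Longrightarrow> distinct (P i)"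
    and no_2_bridge: "\<lbrakk>i \<in> I; j \<in> I; precedes (P i) x y; precedes (P j) x y\<rbrakk> \<Longrightarrow> i = j"
    and no_3_bridge: "\<lbrakk>i \<in> I; j \<in> I; k \<in> I; precedes (P i) x y; precedes (P j) y z; precedes (P k) x z\<rbrakk>
      \<Longrightarrow> \<not> distinct [i, j, k]"
    and no_4_bridge: "\<lbrakk>i \<in> I; j \<in> I; k \<in> I; l \<in> I; precedes (P i) x y; precedes (P j) y z;
      precedes (P k) z w; precedes (P l) x w\<rbrakk> \<Longrightarrow> \<not> distinct [i, j, k, l]"
begin

abbreviation nodes :: "'i \<Rightarrow> 'a set" where "nodes i \<equiv> set (P i)"

abbreviation pos :: "'i \<Rightarrow> 'a \<Rightarrow> nat" where "pos i \<equiv> position (P i)"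

abbreviation before :: "'i \<Rightarrow> 'a \<Rightarrow> 'a \<Rightarrow> bool" where "before i \<equiv> precedes (P i)"

lemma before_iff: "i \<in> I \<Longrightarrow> before i x y \<longleftrightarrow> x \<in> nodes i \<and> y \<in> nodes i \<and> pos i x < pos i y"
  by (simp add: distinct_path precedes_iff_position)

lemma before_mem: "i \<in> I \<Longrightarrow> before i x y \<Longrightarrow> x \<in> nodes i \<and> y \<in> nodes i \<and> x \<noteq> y"
  using before_iff by blast

lemma before_asym: "i \<in> I \<Longrightarrow> before i x y \<Longrightarrow> \<not> before i y x"
  using before_iff by fastforce

lemma before_trans: "i \<in> I \<Longrightarrow> before i x y \<Longrightarrow> before i y z \<Longrightarrow> before i x z"
  using before_iff by auto

lemma before_total: "\<lbrakk>i \<in> I; x \<in> nodes i; y \<in> nodes i; x \<noteq> y\<rbrakk> \<Longrightarrow> before i x y \<or> before i y x"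
  using before_iff inj_onD[OF inj_on_position] by (metis linorder_neqE_nat)

lemma before_flip: "\<lbrakk>i \<in> I; j \<in> I; i \<noteq> j; before i x y; x \<in> nodes j; y \<in> nodes j\<rbrakk> \<Longrightarrow> before j y x"
  using before_total no_2_bridge before_mem by metis

lemma bridge_free_filter:
  assumes "J \<subseteq> I"
  shows "bridge_free_family J (\<lambda>i. filter (Q i) (P i))"
proof
  show "finite J"
    using assms finite_I finite_subset by blast
  show "distinct (filter (Q i) (P i))" if "i \<in> J" for i
    using assms distinct_path that by auto
  show "i = j"
    if "i \<in> J" "j \<in> J" "precedes (filter (Q i) (P i)) x y" "precedes (filter (Q j) (P j)) x y"
    for i j x y
    using no_2_bridge[OF _ _ that(3-4)[THEN precedes_filterD]] that(1,2) assms by blast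
  show "\<not> distinct [i, j, k]"
    if "i \<in> J" "j \<in> J" "k \<in> J" "precedes (filter (Q i) (P i)) x y"
      "precedes (filter (Q j) (P j)) y z" "precedes (filter (Q k) (P k)) x z" for i j k x y z
    using no_3_bridge[OF _ _ _ that(4-6)[THEN precedes_filterD]] that(1-3) assms by blast
  show "\<not> distinct [i, j, k, l]"
    if "i \<in> J" "j \<in> J" "k \<in> J" "l \<in> J" "precedes (filter (Q i) (P i)) x y"
      "precedes (filter (Q j) (P j)) y z" "precedes (filter (Q k) (P k)) z w"
      "precedes (filter (Q l) (P l)) x w" for i j k l x y z w
    using no_4_bridge[OF _ _ _ _ that(5-8)[THEN precedes_filterD]] that(1-4) assms by blast
qed

definition earlier_meetings :: "'a set \<Rightarrow> 'i \<Rightarrow> 'a \<Rightarrow> 'i set" where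
  "earlier_meetings T i x = {j\<in>I. j \<noteq> i \<and> x \<in> nodes j \<and> (\<exists>y\<in>T \<inter> nodes j. before i y x)}"

lemma finite_earlier_meetings: "finite (earlier_meetings T i x)"
  using finite_I by (auto simp: earlier_meetings_def)

lemma earlier_meetings_mono: "T \<subseteq> T' \<Longrightarrow> earlier_meetings T i x \<subseteq> earlier_meetings T' i x"
  by (auto simp: earlier_meetings_def)

text \<open>Two paths visit common nodes in opposite orders. So if a path \<open>k\<close> through \<open>y\<close> other than \<open>j\<close>
  meets \<open>i\<close> at an earlier node \<open>z\<close>, then \<open>x\<close>, \<open>y\<close>, \<open>z\<close>, \<open>w\<close> form a 4-bridge with \<open>j\<close>, \<open>k\<close>, \<open>i\<close>, \<open>l\<close>.\<close>

lemma earlier_meetings_before_two: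
  assumes i: "i \<in> I" and jl: "j \<in> I" "l \<in> I" "j \<noteq> i" "l \<noteq> i" "j \<noteq> l" "x \<in> nodes j" "x \<in> nodes l"
    and w: "before i w x" "w \<in> nodes l" and y: "before i y w" "y \<in> nodes j"
  shows "earlier_meetings (nodes i) i y \<subseteq> {j}"
proof
  fix k assume "k \<in> earlier_meetings (nodes i) i y"
  then obtain z where k: "k \<in> I" "k \<noteq> i" "y \<in> nodes k" and z: "z \<in> nodes k" "before i z y"
    by (auto simp: earlier_meetings_def)
  have yx: "before i y x" and zw: "before i z w"
    using before_trans i w y z by blast+
  have flips: "before j x y" "before l x w" "before k y z"
    using before_flip[OF i] jl k w y(2) z yx by blast+
  have "k = j \<or> k = l"
    using no_4_bridge[OF jl(1) k(1) i jl(2) flips(1,3) zw flips(2)] jl k by auto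
  moreover have "k \<noteq> l"
    using no_2_bridge[OF jl(1) k(1) flips(1)] before_flip[OF i k(1) _ yx] jl k by blast
  ultimately show "k \<in> {j}" by blast
qed

lemma exists_last_earlier_meeting:
  assumes i: "i \<in> I" and nonempty: "earlier_meetings (nodes i) i x \<noteq> {}"
  obtains w l where "l \<in> earlier_meetings (nodes i) i x" "w \<in> nodes l" "before i w x"
    and "\<forall>j\<in>earlier_meetings (nodes i) i x. \<forall>y\<in>nodes j. before i y x \<longrightarrow> y = w \<or> before i y w"
proof -
  define met where "met y \<longleftrightarrow> before i y x \<and> (\<exists>j\<in>earlier_meetings (nodes i) i x. y \<in> nodes j)" for y
  have "\<exists>y. met y"
    using nonempty unfolding met_def earlier_meetings_def by fastforce
  moreover have "\<forall>y. met y \<longrightarrow> pos i y < length (P i)"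
    unfolding met_def using before_mem[OF i] position_less by metis
  ultimately obtain w where w: "met w" "\<forall>y. met y \<longrightarrow> pos i y \<le> pos i w"
    using ex_has_greatest_nat[of met _ "pos i"] by metis
  have "y = w \<or> before i y w" if y: "met y" for y
  proof -
    have "\<not> before i w y"
      using w(2) y before_iff[OF i, of w y] by auto
    moreover have "y \<in> nodes i" "w \<in> nodes i"
      using y w(1) before_mem[OF i] unfolding met_def by blast+
    ultimately show ?thesis
      using before_total[OF i] by blast
  qed
  then show thesis
    using that w(1) unfolding met_def by blast
qed

text \<open>Let \<open>l\<close> be the path of the last earlier meeting \<open>w\<close>. Any other path counted here would meet \<open>T\<close>
  before \<open>w\<close>, at a node with at most one earlier meeting.\<close>

lemma card_earlier_meetings_le_1:
  assumes i: "i \<in> I" and T: "T \<subseteq> nodes i" "\<And>y. y \<in> T \<Longrightarrow> 2 \<le> card (earlier_meetings (nodes i) i y)"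
    and x: "x \<in> nodes i"
  shows "card (earlier_meetings T i x) \<le> 1"
proof (cases "earlier_meetings T i x = {}")
  case False
  then have "earlier_meetings (nodes i) i x \<noteq> {}"
    using earlier_meetings_mono[OF T(1)] by blast
  then obtain w l where "l \<in> earlier_meetings (nodes i) i x" "w \<in> nodes l" and wx: "before i w x"
    and last: "\<forall>j\<in>earlier_meetings (nodes i) i x. \<forall>y\<in>nodes j. before i y x \<longrightarrow> y = w \<or> before i y w"
    by (rule exists_last_earlier_meeting[OF i])
  then have l: "l \<in> I" "l \<noteq> i" "x \<in> nodes l" "w \<in> nodes l"
    unfolding earlier_meetings_def by blast+
  have "j = l" if meeting: "j \<in> earlier_meetings T i x" for j
  proof (rule ccontr)
    assume "j \<noteq> l"
    obtain y where j: "j \<in> I" "j \<noteq> i" "x \<in> nodes j" and y: "y \<in> T" "y \<in> nodes j" "before i y x"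
      using meeting unfolding earlier_meetings_def by blast
    have "y \<noteq> w"
    proof
      assume "y = w"
      then have "before j x y" "before l x y"
        using before_flip[OF i j(1) j(2)[symmetric] y(3) y(2) j(3)]
          before_flip[OF i l(1) l(2)[symmetric] wx l(4) l(3)] by simp_all
      then show False
        using no_2_bridge[OF j(1) l(1)] \<open>j \<noteq> l\<close> by blast
    qed
    moreover have "j \<in> earlier_meetings (nodes i) i x"
      using meeting earlier_meetings_mono[OF T(1)] by blast
    ultimately have "before i y w"
      using last y(2,3) by blast
    then have "earlier_meetings (nodes i) i y \<subseteq> {j}"
      using earlier_meetings_before_two[OF i j(1) l(1) j(2) l(2) \<open>j \<noteq> l\<close> j(3) l(3) wx l(4) _ y(2)]
      by blast
    then have "card (earlier_meetings (nodes i) i y) \<le> 1"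
      using card_mono[of "{j}" "earlier_meetings (nodes i) i y"] by simp
    then show False
      using T(2)[OF y(1)] by linarith
  qed
  then have "earlier_meetings T i x \<subseteq> {l}"
    by blast
  then show ?thesis
    using card_mono[of "{l}" "earlier_meetings T i x"] by simp
qed simp

lemma exists_half_with_few_earlier_meetings:
  assumes i: "i \<in> I"
  shows "\<exists>T\<subseteq>nodes i. length (P i) \<le> 2 * card T \<and> (\<forall>x\<in>T. card (earlier_meetings T i x) \<le> 1)"
proof -
  define busy where "busy = {x\<in>nodes i. 2 \<le> card (earlier_meetings (nodes i) i x)}"
  have "card (earlier_meetings busy i x) \<le> 1" if "x \<in> busy" for x
    by (rule card_earlier_meetings_le_1[OF i]) (use that in \<open>auto simp: busy_def\<close>)
  moreover have "card (earlier_meetings (nodes i - busy) i x) \<le> 1" if "x \<in> nodes i - busy" for x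
  proof -
    have "card (earlier_meetings (nodes i - busy) i x) \<le> card (earlier_meetings (nodes i) i x)"
      by (intro card_mono finite_earlier_meetings earlier_meetings_mono) auto
    then show ?thesis
      using that by (auto simp: busy_def)
  qed
  moreover have "busy \<subseteq> nodes i"
    by (auto simp: busy_def)
  moreover have "length (P i) = card busy + card (nodes i - busy)"
    using card_Int_Diff[of "nodes i" busy] distinct_card[OF distinct_path[OF i]]
      Int_absorb1[OF \<open>busy \<subseteq> nodes i\<close>] by simp
  then have "length (P i) \<le> 2 * card busy \<or> length (P i) \<le> 2 * card (nodes i - busy)"
    by linarith
  ultimately show ?thesis by blast
qed

definition entangled :: "'i \<Rightarrow> 'a \<Rightarrow> 'i set" where
  "entangled i x = {j\<in>I. x \<in> nodes j \<and> (j = i \<or> nodes i \<inter> nodes j \<noteq> {x})}"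

lemma finite_entangled: "finite (entangled i x)"
  using finite_I by (auto simp: entangled_def)

lemma sum_entangled_le:
  assumes i: "i \<in> I" and few: "\<And>x. x \<in> nodes i \<Longrightarrow> card (earlier_meetings (nodes i) i x) \<le> 1"
  shows "(\<Sum>x\<in>nodes i. card (entangled i x)) \<le> 3 * length (P i)"
proof -
  let ?O = "I - {i}" and ?M = "\<lambda>j. nodes i \<inter> nodes j"
  have fin: "finite ?O"
    using finite_I by blast
  have swap: "(\<Sum>x\<in>nodes i. card {j\<in>?O. x \<in> ?M j \<and> R j x}) = (\<Sum>j\<in>?O. card {x\<in>?M j. R j x})" for R
    by (rule sum_multicount_gen[OF _ fin]) (auto intro: arg_cong[where f = card])
  have "card (entangled i x) \<le> 1 + card {j\<in>?O. x \<in> ?M j \<and> ?M j \<noteq> {x}}" if "x \<in> nodes i" for x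
  proof -
    have "card (entangled i x) \<le> card (insert i {j\<in>?O. x \<in> ?M j \<and> ?M j \<noteq> {x}})"
      using fin that by (intro card_mono) (auto simp: entangled_def)
    also have "\<dots> \<le> 1 + card {j\<in>?O. x \<in> ?M j \<and> ?M j \<noteq> {x}}"
      by (simp add: card_insert_if finite_I)
    finally show ?thesis .
  qed
  then have "(\<Sum>x\<in>nodes i. card (entangled i x))
      \<le> (\<Sum>x\<in>nodes i. 1 + card {j\<in>?O. x \<in> ?M j \<and> ?M j \<noteq> {x}})"
    by (intro sum_mono)
  also have "\<dots> = card (nodes i) + (\<Sum>j\<in>?O. card {x\<in>?M j. ?M j \<noteq> {x}})"
    by (simp only: sum.distrib swap) simp
  also have "(\<Sum>j\<in>?O. card {x\<in>?M j. ?M j \<noteq> {x}})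
      \<le> (\<Sum>j\<in>?O. 2 * card {x\<in>?M j. \<exists>y\<in>?M j. before i y x})"
    using distinct_path[OF i] by (intro sum_mono card_nonsingleton_le) auto
  also have "\<dots> = 2 * (\<Sum>x\<in>nodes i. card {j\<in>?O. x \<in> ?M j \<and> (\<exists>y\<in>?M j. before i y x)})"
    by (simp only: swap sum_distrib_left)
  also have "(\<Sum>x\<in>nodes i. card {j\<in>?O. x \<in> ?M j \<and> (\<exists>y\<in>?M j. before i y x)})
      = (\<Sum>x\<in>nodes i. card (earlier_meetings (nodes i) i x))"
    by (intro sum.cong arg_cong[where f = card]) (auto simp: earlier_meetings_def)
  also have "(\<Sum>x\<in>nodes i. card (earlier_meetings (nodes i) i x)) \<le> card (nodes i)"
    using sum_mono[OF few] by simp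
  finally show ?thesis
    by (simp add: distinct_card distinct_path i)
qed

section \<open>Ladders\<close>

definition rung_between :: "'i \<Rightarrow> 'i \<Rightarrow> 'i \<Rightarrow> 'a \<Rightarrow> 'a \<Rightarrow> bool" where
  "rung_between i j k x y \<longleftrightarrow> j \<in> I \<and> distinct [i, j, k] \<and>
    nodes i \<inter> nodes j = {x} \<and> nodes j \<inter> nodes k = {y} \<and> before j x y"

text \<open>The ends of a rung determine it because there are no 2-bridges.\<close>

definition ladder :: "'i \<Rightarrow> 'i \<Rightarrow> ('a \<times> 'a) set" where
  "ladder i k = {(x, y). \<exists>j. rung_between i j k x y}"

lemma ladderI: "rung_between i j k x y \<Longrightarrow> (x, y) \<in> ladder i k"
  by (auto simp: ladder_def)

lemma ladderE:
  assumes "(x, y) \<in> ladder i k"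
  obtains j where "rung_between i j k x y"
  using assms by (auto simp: ladder_def)

lemma ladder_mem: "(x, y) \<in> ladder i k \<Longrightarrow> x \<in> nodes i \<and> y \<in> nodes k"
  by (auto simp: ladder_def rung_between_def)

lemma finite_ladder: "finite (ladder i k)"
  using ladder_mem by (auto intro!: finite_subset[of "ladder i k" "nodes i \<times> nodes k"])

lemma ladder_functional:
  assumes ik: "i \<in> I" "k \<in> I" and mem: "(x, y) \<in> ladder i k" "(x, y') \<in> ladder i k"
  shows "y = y'"
proof (rule ccontr)
  assume "y \<noteq> y'"
  obtain j j' where rungs: "rung_between i j k x y" "rung_between i j' k x y'"
    using mem by (elim ladderE)
  then have I: "j \<in> I" "j' \<in> I" and steps: "before j x y" "before j' x y'"
    by (auto simp: rung_between_def)
  have "distinct [j, k, j']"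
    using rungs \<open>y \<noteq> y'\<close> by (auto simp: rung_between_def)
  moreover have "before k y y' \<or> before k y' y"
    using before_total[OF ik(2)] ladder_mem[OF mem(1)] ladder_mem[OF mem(2)] \<open>y \<noteq> y'\<close> by blast
  ultimately show False
    using no_3_bridge[OF I(1) ik(2) I(2) steps(1) _ steps(2)]
      no_3_bridge[OF I(2) ik(2) I(1) steps(2) _ steps(1)] by auto
qed

lemma ladder_before:
  assumes ik: "i \<in> I" "k \<in> I" and mem: "(x, y) \<in> ladder i k" "(x', y') \<in> ladder i k"
    and less: "before i x x'"
  shows "before k y y'"
proof -
  obtain j j' where rungs: "rung_between i j k x y" "rung_between i j' k x' y'"
    using mem by (elim ladderE)
  then have I: "j \<in> I" "j' \<in> I" and steps: "before j x y" "before j' x' y'"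
    by (auto simp: rung_between_def)
  have paths: "distinct [i, j', k, j]"
    using rungs before_mem[OF ik(1) less] by (auto simp: rung_between_def)
  then have "y \<noteq> y'"
    using no_3_bridge[OF ik(1) I(2,1) less steps(2)] steps(1) by auto
  moreover have "\<not> before k y' y"
    using no_4_bridge[OF ik(1) I(2) ik(2) I(1) less steps(2) _ steps(1)] paths by auto
  ultimately show ?thesis
    using before_total[OF ik(2)] ladder_mem[OF mem(1)] ladder_mem[OF mem(2)] by blast
qed

lemma ladder_pos_less_iff:
  assumes ik: "i \<in> I" "k \<in> I" and mem: "(x, y) \<in> ladder i k" "(x', y') \<in> ladder i k"
  shows "pos i x < pos i x' \<longleftrightarrow> pos k y < pos k y'"
proof -
  have "before i x x' \<longleftrightarrow> before k y y'"
  proof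
    assume y: "before k y y'"
    then have "x \<noteq> x'" "\<not> before i x' x"
      using ladder_functional[OF ik mem(1)] ladder_before[OF ik mem(2,1)] mem(2)
        before_mem[OF ik(2) y] before_asym[OF ik(2) y] by blast+
    then show "before i x x'"
      using before_total[OF ik(1)] ladder_mem[OF mem(1)] ladder_mem[OF mem(2)] by blast
  qed (rule ladder_before[OF ik mem])
  then show ?thesis
    using ladder_mem[OF mem(1)] ladder_mem[OF mem(2)] ik by (simp add: before_iff)
qed

lemma ladder_pos_inj:
  assumes "i \<in> I" "k \<in> I"
  shows "inj_on (\<lambda>c. pos i (fst c)) (ladder i k)" "inj_on (\<lambda>c. pos k (snd c)) (ladder i k)"
proof -
  have "c = c'" if c: "c \<in> ladder i k" "c' \<in> ladder i k"
    and eq: "pos i (fst c) = pos i (fst c') \<or> pos k (snd c) = pos k (snd c')" for c c'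
  proof -
    have "pos i (fst c) = pos i (fst c')" "pos k (snd c) = pos k (snd c')"
      using ladder_pos_less_iff[OF assms] c eq by (metis linorder_neqE_nat prod.collapse less_irrefl)+
    then show ?thesis
      using inj_onD[OF inj_on_position] ladder_mem c by (metis prod.collapse)
  qed
  then show "inj_on (\<lambda>c. pos i (fst c)) (ladder i k)" "inj_on (\<lambda>c. pos k (snd c)) (ladder i k)"
    by (auto intro!: inj_onI)
qed

end

section \<open>Pairs of two-step walks with common ends\<close>

type_synonym ('i, 'a) steps = "'i \<Rightarrow> 'a \<Rightarrow> 'a \<Rightarrow> bool"

type_synonym ('i, 'a) walk = "'a \<times> 'i \<times> 'a \<times> 'i \<times> 'a"

text \<open>The labels split every node virtually into nodes of degree between \<open>d\<close> and \<open>2 * d\<close>.\<close>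

locale dense_family = bridge_free_family I P
  for I :: "'i set" and P :: "'i \<Rightarrow> 'a list" +
  fixes label :: "'a \<Rightarrow> 'i \<Rightarrow> nat" and d :: nat
  assumes sum_entangled: "i \<in> I \<Longrightarrow> (\<Sum>x\<in>nodes i. card (entangled i x)) \<le> 3 * length (P i)"
    and card_label_class: "\<lbrakk>i \<in> I; x \<in> nodes i\<rbrakk>
      \<Longrightarrow> card {j\<in>I. x \<in> nodes j \<and> label x j = label x i} \<in> {d..2 * d}"
begin

definition total_length :: nat where
  "total_length = (\<Sum>i\<in>I. length (P i))"

definition corner :: "'a \<Rightarrow> 'i \<Rightarrow> 'i \<Rightarrow> bool" where
  "corner a i j \<longleftrightarrow> i \<in> I \<and> j \<in> I \<and> i \<noteq> j \<and> nodes i \<inter> nodes j = {a} \<and> label a i = label a j"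

definition walks :: "('i, 'a) steps \<Rightarrow> ('i, 'a) steps \<Rightarrow> ('i, 'a) walk set" where
  "walks F G = {(u, i, a, j, v). corner a i j \<and> F i u a \<and> G j a v}"

definition ends :: "('i, 'a) walk \<Rightarrow> 'a \<times> 'a" where
  "ends = (\<lambda>(u, i, a, j, v). (u, v))"

definition same_end_pairs ::
  "('i, 'a) steps \<Rightarrow> ('i, 'a) steps \<Rightarrow> (('i, 'a) walk \<times> ('i, 'a) walk) set" where
  "same_end_pairs F G = fibre_product ends (walks F G) ends (walks F G)"

definition first_entangled :: "('i, 'a) walk \<times> ('i, 'a) walk \<Rightarrow> bool" where
  "first_entangled = (\<lambda>((u, i, a, j, v), (u', i', a', j', v')). i' \<in> entangled i u)"

definition last_entangled :: "('i, 'a) walk \<times> ('i, 'a) walk \<Rightarrow> bool" where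
  "last_entangled = (\<lambda>((u, i, a, j, v), (u', i', a', j', v')). j' \<in> entangled j v)"

definition ladder_steps ::
  "('i, 'a) steps \<Rightarrow> ('i, 'a) steps \<Rightarrow> 'i \<Rightarrow> 'i \<Rightarrow> (('a \<times> 'a) \<times> ('a \<times> 'a)) set" where
  "ladder_steps F G i k =
    {(c, c') \<in> ladder i k \<times> ladder i k. F i (fst c) (fst c') \<and> G k (snd c) (snd c')}"

definition step_relation :: "('i, 'a) steps \<Rightarrow> nat \<Rightarrow> bool" where
  "step_relation F f \<longleftrightarrow> (\<forall>i x y. F i x y \<longrightarrow> i \<in> I \<and> before i x y) \<and>
    (\<forall>i x. card {y. F i x y} \<le> f \<and> card {y. F i y x} \<le> f)"

lemma step_relationD:
  assumes "step_relation F f" "F i x y"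
  shows "i \<in> I" "before i x y"
  using assms by (auto simp: step_relation_def)

lemma step_relation_fibres:
  assumes "step_relation F f"
  shows "finite {y. F i x y} \<and> card {y. F i x y} \<le> f" "finite {y. F i y x} \<and> card {y. F i y x} \<le> f"
proof -
  have "{y. F i x y} \<subseteq> nodes i" "{y. F i y x} \<subseteq> nodes i"
    using step_relationD[OF assms] before_mem by blast+
  then show "finite {y. F i x y} \<and> card {y. F i x y} \<le> f" "finite {y. F i y x} \<and> card {y. F i y x} \<le> f"
    using assms finite_subset by (auto simp: step_relation_def)
qed

lemma corner_sym: "corner a i j \<longleftrightarrow> corner a j i"
  unfolding corner_def by auto

lemma corner_mem: "corner a i j \<Longrightarrow> i \<in> I \<and> j \<in> I \<and> a \<in> nodes i \<and> a \<in> nodes j"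
  unfolding corner_def by auto

lemma finite_corners: "finite {j. corner a i j}"
  by (rule finite_subset[OF _ finite_I]) (auto simp: corner_def)

lemma card_corners_le: "card {j. corner a i j} \<le> 2 * d"
proof (cases "i \<in> I \<and> a \<in> nodes i")
  case True
  have "card {j. corner a i j} \<le> card {j\<in>I. a \<in> nodes j \<and> label a j = label a i}"
    using finite_I by (intro card_mono) (auto simp: corner_def)
  then show ?thesis
    using card_label_class[of i a] True by simp
next
  case False
  then have none: "{j. corner a i j} = {}"
    using corner_mem by blast
  show ?thesis
    unfolding none by simp
qed

lemma card_corners_ge:
  assumes "i \<in> I" "a \<in> nodes i"
  shows "d \<le> card {j. corner a i j} + card (entangled i a)"
proof -
  have "{j\<in>I. a \<in> nodes j \<and> label a j = label a i} \<subseteq> {j. corner a i j} \<union> entangled i a"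
    using assms by (auto simp: corner_def entangled_def)
  then have "card {j\<in>I. a \<in> nodes j \<and> label a j = label a i} \<le> card ({j. corner a i j} \<union> entangled i a)"
    using finite_corners finite_entangled by (intro card_mono) auto
  also have "\<dots> \<le> card {j. corner a i j} + card (entangled i a)"
    by (rule card_Un_le)
  finally show ?thesis
    using card_label_class[OF assms] by simp
qed

lemma walk_mem:
  assumes "step_relation F f" "step_relation G h" "(u, i, a, j, v) \<in> walks F G"
  shows "i \<in> I \<and> j \<in> I \<and> u \<in> nodes i \<and> a \<in> nodes i \<and> a \<in> nodes j \<and> v \<in> nodes j"
proof -
  have "corner a i j" "before i u a" "before j a v"
    using assms step_relationD(2) by (auto simp: walks_def)
  then show ?thesis
    using corner_mem before_mem by metis
qed

lemma finite_walks:
  assumes "step_relation F f" "step_relation G h"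
  shows "finite (walks F G)"
proof -
  let ?V = "\<Union>i\<in>I. nodes i"
  have "walks F G \<subseteq> ?V \<times> I \<times> ?V \<times> I \<times> ?V"
    using walk_mem[OF assms] by fast
  then show ?thesis
    by (rule finite_subset) (use finite_I in auto)
qed

definition walks_to :: "('i, 'a) steps \<Rightarrow> ('i, 'a) steps \<Rightarrow> 'i \<Rightarrow> 'a \<Rightarrow> ('a \<times> 'i \<times> 'a) set" where
  "walks_to F G j v = {(a, i, u). (u, i, a, j, v) \<in> walks F G}"

definition walks_from :: "('i, 'a) steps \<Rightarrow> ('i, 'a) steps \<Rightarrow> 'i \<Rightarrow> 'a \<Rightarrow> ('a \<times> 'i \<times> 'a) set" where
  "walks_from F G i u = {(a, j, v). (u, i, a, j, v) \<in> walks F G}"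

lemma card_walks_to_le:
  assumes F: "step_relation F f" and G: "step_relation G h"
  shows "finite (walks_to F G j v) \<and> card (walks_to F G j v) \<le> 2 * d * f * h"
proof -
  have "walks_to F G j v = (SIGMA a:{a. G j a v}. SIGMA i:{i. corner a j i}. {u. F i u a})"
    using corner_sym by (auto simp: walks_to_def walks_def)
  then show ?thesis
    using finite_card_iterated_Sigma_le
        [of "{a. G j a v}" h "\<lambda>a. {i. corner a j i}" "2 * d" "\<lambda>a i. {u. F i u a}" f]
      step_relation_fibres(2)[OF F] step_relation_fibres(2)[OF G] finite_corners card_corners_le
    by (simp add: mult_ac)
qed

lemma card_walks_from_le:
  assumes F: "step_relation F f" and G: "step_relation G h"
  shows "finite (walks_from F G i u) \<and> card (walks_from F G i u) \<le> 2 * d * f * h"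
proof -
  have "walks_from F G i u = (SIGMA a:{a. F i u a}. SIGMA j:{j. corner a i j}. {v. G j a v})"
    by (auto simp: walks_from_def walks_def)
  then show ?thesis
    using finite_card_iterated_Sigma_le
        [of "{a. F i u a}" f "\<lambda>a. {j. corner a i j}" "2 * d" "\<lambda>a j. {v. G j a v}" h]
      step_relation_fibres(1)[OF F] step_relation_fibres(1)[OF G] finite_corners card_corners_le
    by (simp add: mult_ac)
qed

lemma walk_eqI:
  assumes F: "step_relation F f" and G: "step_relation G h"
    and walks: "(u, i, a, j, v) \<in> walks F G" "(u, i', a', j', v) \<in> walks F G"
    and shared: "i = i' \<or> j = j'"
  shows "i = i' \<and> a = a' \<and> j = j'"
proof -
  have corners: "corner a i j" "corner a' i' j'"
    and steps: "before i u a" "before j a v" "before i' u a'" "before j' a' v"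
    using walks step_relationD(2)[OF F] step_relationD(2)[OF G] by (auto simp: walks_def)
  note mem = corner_mem[OF corners(1)] corner_mem[OF corners(2)]
  have ne: "i \<noteq> j" "i' \<noteq> j'" and meet: "nodes i \<inter> nodes j = {a}" "nodes i' \<inter> nodes j' = {a'}"
    using corners by (auto simp: corner_def)
  show ?thesis
  proof (cases "a = a'")
    case True
    then show ?thesis
      using no_2_bridge[of i i' u a] no_2_bridge[of j j' a v] steps mem by auto
  next
    case False
    have "\<not> (i = i' \<and> j = j')"
      using False meet by auto
    moreover have "j = j'" if "i = i'"
      using before_total[of i a a'] False mem no_3_bridge[of i j' j a a' v]
        no_3_bridge[of i j j' a' a v] steps ne that by auto
    moreover have "i = i'" if "j = j'"
      using before_total[of j a a'] False mem no_3_bridge[of i j i' u a a']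
        no_3_bridge[of i' j i u a' a] steps ne that by auto
    ultimately show ?thesis using shared by auto
  qed
qed

lemma mem_same_end_pairs [simp]:
  "((u, i, a, j, v), (u', i', a', j', v')) \<in> same_end_pairs F G \<longleftrightarrow>
    u' = u \<and> v' = v \<and> (u, i, a, j, v) \<in> walks F G \<and> (u, i', a', j', v) \<in> walks F G"
  by (auto simp: same_end_pairs_def fibre_product_def ends_def)

lemma card_entangled_extensions_le:
  assumes "\<And>i x. i \<in> I \<Longrightarrow> finite (A i x) \<and> card (A i x) \<le> c"
  shows "card (SIGMA i:I. SIGMA x:nodes i. A i x \<times> entangled i x) \<le> 3 * c * total_length"
proof -
  have "card (SIGMA i:I. SIGMA x:nodes i. A i x \<times> entangled i x)
      = (\<Sum>i\<in>I. \<Sum>x\<in>nodes i. card (A i x) * card (entangled i x))"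
    using assms finite_I finite_entangled by (simp add: card_cartesian_product)
  also have "\<dots> \<le> (\<Sum>i\<in>I. \<Sum>x\<in>nodes i. c * card (entangled i x))"
    using assms by (intro sum_mono mult_le_mono1) auto
  also have "\<dots> \<le> (\<Sum>i\<in>I. c * (3 * length (P i)))"
    by (intro sum_mono) (simp add: sum_distrib_left[symmetric] sum_entangled)
  finally show ?thesis
    by (simp add: total_length_def sum_distrib_left mult_ac)
qed

lemma card_last_entangled_pairs_le:
  assumes F: "step_relation F f" and G: "step_relation G h"
  shows "card {q \<in> same_end_pairs F G. last_entangled q} \<le> 6 * d * f * h * total_length"
    (is "card ?X \<le> _")
proof -

  let ?E = "SIGMA j:I. SIGMA v:nodes j. walks_to F G j v \<times> entangled j v"
  have "card ?X \<le> card ?E"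
  proof (rule card_inj_on_le[of "\<lambda>((u, i, a, j, v), (u', i', a', j', v')). (j, v, (a, i, u), j')"])
    show "inj_on (\<lambda>((u, i, a, j, v), (u', i', a', j', v')). (j, v, (a, i, u), j')) ?X"
      by (rule inj_onI) (clarsimp, metis walk_eqI[OF F G])
    show "(\<lambda>((u, i, a, j, v), (u', i', a', j', v')). (j, v, (a, i, u), j')) ` ?X \<subseteq> ?E"
      by (rule image_subsetI)
        (clarsimp simp: walks_to_def last_entangled_def, metis walk_mem[OF F G])
    show "finite ?E"
      using finite_I card_walks_to_le[OF F G] finite_entangled by auto
  qed
  also have "\<dots> \<le> 3 * (2 * d * f * h) * total_length"
    using card_walks_to_le[OF F G] by (intro card_entangled_extensions_le) auto
  finally show ?thesis by simp
qed

lemma card_first_entangled_pairs_le: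
  assumes F: "step_relation F f" and G: "step_relation G h"
  shows "card {q \<in> same_end_pairs F G. first_entangled q} \<le> 6 * d * f * h * total_length"
    (is "card ?X \<le> _")
proof -
  let ?E = "SIGMA i:I. SIGMA u:nodes i. walks_from F G i u \<times> entangled i u"
  have "card ?X \<le> card ?E"
  proof (rule card_inj_on_le[of "\<lambda>((u, i, a, j, v), (u', i', a', j', v')). (i, u, (a, j, v), i')"])
    show "inj_on (\<lambda>((u, i, a, j, v), (u', i', a', j', v')). (i, u, (a, j, v), i')) ?X"
      by (rule inj_onI) (clarsimp, metis walk_eqI[OF F G])
    show "(\<lambda>((u, i, a, j, v), (u', i', a', j', v')). (i, u, (a, j, v), i')) ` ?X \<subseteq> ?E"
      by (rule image_subsetI)
        (clarsimp simp: walks_from_def first_entangled_def, metis walk_mem[OF F G])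
    show "finite ?E"
      using finite_I card_walks_from_le[OF F G] finite_entangled by auto
  qed
  also have "\<dots> \<le> 3 * (2 * d * f * h) * total_length"
    using card_walks_from_le[OF F G] by (intro card_entangled_extensions_le) auto
  finally show ?thesis by simp
qed

lemma unentangled_pair_on_ladder:
  assumes F: "step_relation F f" and G: "step_relation G h"
    and walks: "(u, i, a, j, v) \<in> walks F G" "(u, i', a', j', v) \<in> walks F G"
    and first: "i' \<notin> entangled i u" and last: "j' \<notin> entangled j v"
  shows "((u, a'), (a, v)) \<in> ladder_steps F G i j'"
proof -
  have steps: "F i u a" "G j a v" "F i' u a'" "G j' a' v"
    and meet: "i \<noteq> j" "i' \<noteq> j'" "nodes i \<inter> nodes j = {a}" "nodes i' \<inter> nodes j' = {a'}"
    using walks by (auto simp: walks_def corner_def)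
  note mem = walk_mem[OF F G walks(1)] walk_mem[OF F G walks(2)]
  have ends: "i \<noteq> i'" "nodes i \<inter> nodes i' = {u}" "j \<noteq> j'" "nodes j \<inter> nodes j' = {v}"
    using first last mem by (auto simp: entangled_def)
  have "before i' u a'" "before j a v"
    using steps step_relationD(2)[OF F] step_relationD(2)[OF G] by blast+
  moreover have "i \<noteq> j'"
    using meet(3) ends(4) mem before_mem[OF _ \<open>before j a v\<close>] by (metis Int_commute singleton_inject)
  ultimately have "(u, a') \<in> ladder i j'" "(a, v) \<in> ladder i j'"
    using mem meet ends ladderI[of i i' j' u a'] ladderI[of i j j' a v] by (auto simp: rung_between_def)
  then show ?thesis
    using steps by (simp add: ladder_steps_def)
qed

lemma card_unentangled_pairs_le:
  assumes F: "step_relation F f" and G: "step_relation G h"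
  shows "card {q \<in> same_end_pairs F G. \<not> first_entangled q \<and> \<not> last_entangled q}
    \<le> (\<Sum>i\<in>I. \<Sum>k\<in>I. card (ladder_steps F G i k))" (is "card ?X \<le> _")
proof -
  let ?E = "SIGMA i:I. SIGMA k:I. ladder_steps F G i k"
  have fin: "finite (ladder_steps F G i k)" for i k
    by (rule finite_subset[of _ "ladder i k \<times> ladder i k"]) (auto simp: ladder_steps_def finite_ladder)
  have "card ?X \<le> card ?E"
  proof (rule card_inj_on_le[of "\<lambda>((u, i, a, j, v), (u', i', a', j', v')). (i, j', (u, a'), (a, v))"])
    show "inj_on (\<lambda>((u, i, a, j, v), (u', i', a', j', v')). (i, j', (u, a'), (a, v))) ?X"
      by (rule inj_onI) (clarsimp, metis walk_eqI[OF F G])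
    show "(\<lambda>((u, i, a, j, v), (u', i', a', j', v')). (i, j', (u, a'), (a, v))) ` ?X \<subseteq> ?E"
      by (rule image_subsetI)
        (clarsimp simp: first_entangled_def last_entangled_def,
          metis walk_mem[OF F G] unentangled_pair_on_ladder[OF F G])
    show "finite ?E"
      using finite_I fin by auto
  qed
  also have "card ?E = (\<Sum>i\<in>I. \<Sum>k\<in>I. card (ladder_steps F G i k))"
    using finite_I fin by simp
  finally show ?thesis .
qed

lemma card_same_end_pairs_le:
  assumes F: "step_relation F f" and G: "step_relation G h"
  shows "card (same_end_pairs F G)
    \<le> 12 * d * f * h * total_length + (\<Sum>i\<in>I. \<Sum>k\<in>I. card (ladder_steps F G i k))"
proof -
  let ?S = "same_end_pairs F G"
  let ?A = "{q \<in> ?S. first_entangled q}" and ?B = "{q \<in> ?S. last_entangled q}"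
    and ?C = "{q \<in> ?S. \<not> first_entangled q \<and> \<not> last_entangled q}"
  have "card ?S = card (?A \<union> ?B \<union> ?C)"
    by (rule arg_cong[where f = card]) blast
  then have "card ?S \<le> card ?A + card ?B + card ?C"
    using card_Un_le[of "?A \<union> ?B" ?C] card_Un_le[of ?A ?B] by linarith
  then show ?thesis
    using card_first_entangled_pairs_le[OF F G] card_last_entangled_pairs_le[OF F G]
      card_unentangled_pairs_le[OF F G] by linarith
qed

end

section \<open>Short steps, long steps and rungs\<close>

type_synonym ('i, 'a) rung = "'i \<times> 'a \<times> 'i \<times> 'a \<times> 'i"

locale scaled_dense_family = dense_family I P label d
  for I :: "'i set" and P :: "'i \<Rightarrow> 'a list" and label d +
  fixes L s :: nat
  assumes length_ge: "i \<in> I \<Longrightarrow> 4 * L \<le> length (P i)"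
    and scales: "0 < L" "0 < s" "s \<le> 4 * L"
    and degree_ge: "48 \<le> d"
begin

definition short_step :: "('i, 'a) steps" where
  "short_step i x y \<longleftrightarrow> i \<in> I \<and> before i x y \<and> pos i x div s = pos i y div s"

definition long_step :: "('i, 'a) steps" where
  "long_step i x y \<longleftrightarrow> i \<in> I \<and> before i x y \<and> pos i x + L \<le> pos i y \<and> pos i y < pos i x + 2 * L"

lemma step_relation_short_step: "step_relation short_step s"
  unfolding step_relation_def
proof (intro conjI allI impI)
  fix i x
  have cell: "n \<in> {m div s * s..<m div s * s + s}" if "n div s = m div s" for n m
    using that scales(2)
    by (metis add.commute atLeastLessThan_iff div_times_less_eq_dividend dividend_less_div_times)
  show "card {y. short_step i x y} \<le> s" "card {y. short_step i y x} \<le> s"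
    using cell
    by (auto intro!: card_le_position_window[of _ "P i" "pos i x div s * s"]
        simp: short_step_def before_iff)
qed (auto simp: short_step_def)

lemma step_relation_long_step: "step_relation long_step L"
  unfolding step_relation_def
proof (intro conjI allI impI)
  fix i x
  show "card {y. long_step i x y} \<le> L"
    by (rule card_le_position_window[of _ "P i" "pos i x + L"])
      (auto simp: long_step_def before_iff)
  show "card {y. long_step i y x} \<le> L"
    by (rule card_le_position_window[of _ "P i" "pos i x + 1 - 2 * L"])
      (auto simp: long_step_def before_iff)
qed (auto simp: long_step_def)

lemma card_ladder_steps_le:
  assumes ik: "i \<in> I" "k \<in> I"
  shows "L * card (ladder_steps short_step long_step i k) \<le> s\<^sup>2 * length (P k)"
    and "L * card (ladder_steps long_step short_step i k) \<le> s\<^sup>2 * length (P i)"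
proof -
  let ?start = "\<lambda>c. pos i (fst c)" and ?end = "\<lambda>c. pos k (snd c)"
  have order: "?start c < ?start c' \<longleftrightarrow> ?end c < ?end c'" if "c \<in> ladder i k" "c' \<in> ladder i k" for c c'
    using ladder_pos_less_iff[OF ik, of "fst c" "snd c"] that by simp
  have bounds: "?start c < length (P i)" "?end c < length (P k)" if "c \<in> ladder i k" for c
    using ladder_mem[of "fst c" "snd c" i k] that by (simp_all add: position_less)
  have fin: "finite (skew_pairs f g s L (ladder i k))" for f g
    by (rule finite_subset[of _ "ladder i k \<times> ladder i k"]) (auto simp: skew_pairs_def finite_ladder)
  note step_simps = ladder_steps_def skew_pairs_def short_step_def long_step_def before_iff
  have "card (ladder_steps short_step long_step i k) \<le> card (skew_pairs ?start ?end s L (ladder i k))"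
    by (intro card_mono fin) (auto simp: step_simps)
  then show "L * card (ladder_steps short_step long_step i k) \<le> s\<^sup>2 * length (P k)"
    using card_skew_pairs_le[OF order ladder_pos_inj(1)[OF ik] bounds(2) scales(2,1)]
      mult_le_mono2 le_trans by meson
  have "card (ladder_steps long_step short_step i k) \<le> card (skew_pairs ?end ?start s L (ladder i k))"
    by (intro card_mono fin) (auto simp: step_simps)
  then show "L * card (ladder_steps long_step short_step i k) \<le> s\<^sup>2 * length (P i)"
    using card_skew_pairs_le[OF order[symmetric] ladder_pos_inj(2)[OF ik] bounds(1) scales(2,1)]
      mult_le_mono2 le_trans by meson
qed

definition thin_diamonds :: "(('i, 'a) walk \<times> ('i, 'a) walk) set" where
  "thin_diamonds = fibre_product ends (walks short_step long_step) ends (walks long_step short_step)"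

lemmas finite_short_long_walks = finite_walks[OF step_relation_short_step step_relation_long_step]
  and finite_long_short_walks = finite_walks[OF step_relation_long_step step_relation_short_step]

lemma finite_thin_diamonds: "finite thin_diamonds"
  unfolding thin_diamonds_def
  by (intro finite_fibre_product finite_short_long_walks finite_long_short_walks)

lemma card_thin_diamonds_le:
  "L * card thin_diamonds \<le> 12 * d * s * L\<^sup>2 * total_length + s\<^sup>2 * card I * total_length"
    (is "_ \<le> ?bound")
proof -
  let ?S = "\<lambda>F G. \<Sum>i\<in>I. \<Sum>k\<in>I. card (ladder_steps F G i k)"
  have "L * ?S short_step long_step \<le> (\<Sum>i\<in>I. \<Sum>k\<in>I. s\<^sup>2 * length (P k))"
    unfolding sum_distrib_left by (intro sum_mono card_ladder_steps_le)
  then have short_long: "L * ?S short_step long_step \<le> s\<^sup>2 * card I * total_length"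
    by (simp add: total_length_def sum_distrib_left mult_ac)
  have "L * ?S long_step short_step \<le> (\<Sum>i\<in>I. \<Sum>k\<in>I. s\<^sup>2 * length (P i))"
    unfolding sum_distrib_left by (intro sum_mono card_ladder_steps_le)
  then have long_short: "L * ?S long_step short_step \<le> s\<^sup>2 * card I * total_length"
    by (simp add: total_length_def sum_distrib_left mult_ac)
  have "L * card (same_end_pairs short_step long_step)
      \<le> L * (12 * d * s * L * total_length + ?S short_step long_step)"
    by (intro mult_le_mono2 card_same_end_pairs_le step_relation_short_step step_relation_long_step)
  moreover have "L * card (same_end_pairs long_step short_step)
      \<le> L * (12 * d * L * s * total_length + ?S long_step short_step)"
    by (intro mult_le_mono2 card_same_end_pairs_le step_relation_short_step step_relation_long_step)
  ultimately have "L * card (same_end_pairs short_step long_step) \<le> ?bound"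
    "L * card (same_end_pairs long_step short_step) \<le> ?bound"
    using short_long long_short by (simp_all add: distrib_left power2_eq_square mult_ac)
  moreover have "L * (2 * card thin_diamonds) \<le>
      L * card (same_end_pairs short_step long_step) + L * card (same_end_pairs long_step short_step)"
    unfolding thin_diamonds_def same_end_pairs_def add_mult_distrib2[symmetric]
    by (intro mult_le_mono2 card_mixed_fibre_product_le finite_short_long_walks finite_long_short_walks)
  ultimately show ?thesis by linarith
qed

definition long_rungs :: "('i, 'a) rung set" where
  "long_rungs = {(i, x, j, y, k). corner x i j \<and> long_step j x y \<and> corner y j k}"

definition rung_cell :: "('i, 'a) rung \<Rightarrow> ('i \<times> 'i) \<times> nat" where
  "rung_cell = (\<lambda>(i, x, j, y, k). ((i, k), pos i x div s + pos k y div s))"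

definition same_cell_pairs :: "(('i, 'a) rung \<times> ('i, 'a) rung) set" where
  "same_cell_pairs = fibre_product rung_cell long_rungs rung_cell long_rungs"

lemma long_rungD:
  assumes "(i, x, j, y, k) \<in> long_rungs"
  shows "(x, y) \<in> ladder i k" "i \<in> I" "j \<in> I" "k \<in> I" "x \<in> nodes i" "y \<in> nodes k" "before j x y"
proof -
  have rung: "corner x i j" "long_step j x y" "corner y j k"
    using assms by (auto simp: long_rungs_def)
  then show I: "i \<in> I" "j \<in> I" "k \<in> I" and "x \<in> nodes i" "y \<in> nodes k" and step: "before j x y"
    using corner_mem by (auto simp: long_step_def)
  have "i \<noteq> k"
    using rung(1,3) before_mem[OF I(2) step] by (auto simp: corner_def)
  then show "(x, y) \<in> ladder i k"
    using rung I step by (auto intro!: ladderI[of i j] simp: corner_def rung_between_def)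
qed

lemma finite_long_rungs: "finite long_rungs"
proof -
  have "long_rungs \<subseteq> I \<times> (\<Union>i\<in>I. nodes i) \<times> I \<times> (\<Union>i\<in>I. nodes i) \<times> I"
    using long_rungD(2-6) by fast
  then show ?thesis
    by (rule finite_subset) (use finite_I in auto)
qed

lemma long_rung_eqI:
  assumes rungs: "(i, x, j, y, k) \<in> long_rungs" "(i, x', j', y', k) \<in> long_rungs"
    and start: "pos i x = pos i x'"
  shows "x = x' \<and> j = j' \<and> y = y'"
proof -
  note r = long_rungD[OF rungs(1)] and r' = long_rungD[OF rungs(2)]
  have "(x, y) = (x', y')"
    using inj_onD[OF ladder_pos_inj(1)[OF r(2,4)] _ r(1) r'(1)] start by simp
  then show ?thesis
    using no_2_bridge[OF r(3) r'(3) r(7)] r'(7) by blast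
qed

text \<open>By monotonicity of ladders, neither of the two summands of the cell number can decrease.\<close>

lemma short_steps_of_same_cell:
  assumes rungs: "(i, x, j, y, k) \<in> long_rungs" "(i, x', j', y', k) \<in> long_rungs"
    and cell: "rung_cell (i, x, j, y, k) = rung_cell (i, x', j', y', k)" and less: "pos i x < pos i x'"
  shows "short_step i x x' \<and> short_step k y y'"
proof -
  note r = long_rungD[OF rungs(1)] and r' = long_rungD[OF rungs(2)]
  have less': "pos k y < pos k y'"
    using ladder_pos_less_iff[OF r(2,4) r(1) r'(1)] less by blast
  have "pos i x div s \<le> pos i x' div s" "pos k y div s \<le> pos k y' div s"
    using less less' by (auto intro: div_le_mono)
  then have "pos i x div s = pos i x' div s" "pos k y div s = pos k y' div s"
    using cell by (auto simp: rung_cell_def)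
  then show ?thesis
    using r r' less less' by (simp add: short_step_def before_iff)
qed

definition starts_earlier :: "('i, 'a) rung \<Rightarrow> ('i, 'a) rung \<Rightarrow> bool" where
  "starts_earlier = (\<lambda>(i, x, j, y, k) (i', x', j', y', k'). pos i x < pos i x')"

lemma card_ordered_same_cell_pairs_le:
  "card {(r, r') \<in> same_cell_pairs. starts_earlier r r'} \<le> card thin_diamonds" (is "card ?Q \<le> _")
proof -
  define diamond :: "('i, 'a) rung \<times> ('i, 'a) rung \<Rightarrow> ('i, 'a) walk \<times> ('i, 'a) walk"
    where "diamond = (\<lambda>((i, x, j, y, k), (i', x', j', y', k')). ((x, i, x', j', y'), (x, j, y, k, y')))"
  have pairD: "i' = i \<and> k' = k \<and> (i, x, j, y, k) \<in> long_rungs \<and> (i, x', j', y', k) \<in> long_rungs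
      \<and> short_step i x x' \<and> short_step k y y'"
    if "((i, x, j, y, k), (i', x', j', y', k')) \<in> ?Q" for i x j y k i' x' j' y' k'
    using that short_steps_of_same_cell[of i x j y k x' j' y']
    by (auto simp: same_cell_pairs_def fibre_product_def starts_earlier_def rung_cell_def)
  show ?thesis
  proof (rule card_inj_on_le[of diamond])
    show "inj_on diamond ?Q"
    proof (rule inj_onI)
      fix q r assume mem: "q \<in> ?Q" "r \<in> ?Q" and eq: "diamond q = diamond r"
      obtain i x j y k i' x' j' y' k' where q: "q = ((i, x, j, y, k), (i', x', j', y', k'))"
        by (metis surj_pair)
      obtain l u m v n l' u' m' v' n' where r: "r = ((l, u, m, v, n), (l', u', m', v', n'))"
        by (metis surj_pair)
      show "q = r"
        using pairD[OF mem(1)[unfolded q]] pairD[OF mem(2)[unfolded r]] eq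
        unfolding q r by (auto simp: diamond_def)
    qed
    show "diamond ` ?Q \<subseteq> thin_diamonds"
    proof (rule image_subsetI)
      fix q assume "q \<in> ?Q"
      moreover obtain i x j y k i' x' j' y' k' where q: "q = ((i, x, j, y, k), (i', x', j', y', k'))"
        by (metis surj_pair)
      ultimately show "diamond q \<in> thin_diamonds"
        using pairD[of i x j y k i' x' j' y' k']
        by (auto simp: diamond_def thin_diamonds_def fibre_product_def ends_def walks_def
            long_rungs_def)
    qed
  qed (rule finite_thin_diamonds)
qed

lemma card_same_cell_pairs_le: "card same_cell_pairs \<le> card long_rungs + 2 * card thin_diamonds"
proof -
  have "starts_earlier r r' \<or> starts_earlier r' r"
    if "r \<in> long_rungs" "r' \<in> long_rungs" "rung_cell r = rung_cell r'" "r \<noteq> r'" for r r'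
    using that
    by (cases r; cases r') (auto simp: starts_earlier_def rung_cell_def neq_iff dest: long_rung_eqI)
  then have "card same_cell_pairs
      \<le> card long_rungs + 2 * card {(r, r') \<in> same_cell_pairs. starts_earlier r r'}"
    unfolding same_cell_pairs_def by (rule card_self_fibre_product_le[OF finite_long_rungs])
  then show ?thesis
    using card_ordered_same_cell_pairs_le by linarith
qed

lemma exists_small_cell_range:
  "\<exists>T. finite T \<and> rung_cell ` long_rungs \<subseteq> T \<and> s * card T \<le> 3 * card I * total_length"
proof -
  let ?cells = "\<lambda>(i, k). {..length (P i) div s + length (P k) div s}"
  have "s * card (Sigma (I \<times> I) ?cells) \<le> (\<Sum>i\<in>I. \<Sum>k\<in>I. 2 * length (P i) + length (P k))"
  proof -
    have "s * (length (P i) div s + length (P k) div s + 1) \<le> 2 * length (P i) + length (P k)"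
      if "i \<in> I" for i k
      using length_ge[OF that] scales(3) times_div_less_eq_dividend[of s "length (P i)"]
        times_div_less_eq_dividend[of s "length (P k)"]
      unfolding distrib_left mult_1_right by linarith
    then have "(\<Sum>i\<in>I. \<Sum>k\<in>I. s * (length (P i) div s + length (P k) div s + 1))
        \<le> (\<Sum>i\<in>I. \<Sum>k\<in>I. 2 * length (P i) + length (P k))"
      by (intro sum_mono)
    then show ?thesis
      using finite_I by (simp add: sum.cartesian_product sum_distrib_left case_prod_beta)
  qed
  also have "\<dots> = card I * (2 * total_length) + card I * total_length"
    by (simp add: sum.distrib total_length_def sum_distrib_left)
  finally have "s * card (Sigma (I \<times> I) ?cells) \<le> 3 * card I * total_length"
    by simp
  moreover have "rung_cell r \<in> Sigma (I \<times> I) ?cells" if "r \<in> long_rungs" for r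
  proof -
    obtain i x j y k where r: "r = (i, x, j, y, k)"
      by (metis surj_pair)
    note rung = long_rungD[OF that[unfolded r]]
    have "pos i x div s + pos k y div s \<le> length (P i) div s + length (P k) div s"
      using rung(5,6)[THEN position_less] by (intro add_mono div_le_mono) auto
    then show ?thesis
      using rung unfolding r rung_cell_def by simp
  qed
  moreover have "finite (Sigma (I \<times> I) ?cells)"
    using finite_I by auto
  ultimately show ?thesis by blast
qed

definition mild_nodes :: "'i \<Rightarrow> 'a set" where
  "mild_nodes j = {x\<in>nodes j. card (entangled j x) \<le> 24}"

definition mild_long_steps :: "'i \<Rightarrow> ('a \<times> 'a) set" where
  "mild_long_steps j = {(x, y) \<in> mild_nodes j \<times> mild_nodes j. long_step j x y}"

lemma finite_mild_long_steps: "finite (mild_long_steps j)"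
  by (rule finite_subset[of _ "nodes j \<times> nodes j"]) (auto simp: mild_long_steps_def mild_nodes_def)

lemma card_mild_nodes_ge:
  assumes j: "j \<in> I"
  shows "7 * length (P j) \<le> 8 * card (mild_nodes j)"
proof -
  have "25 * card (nodes j - mild_nodes j) = (\<Sum>x\<in>nodes j - mild_nodes j. 25)"
    by simp
  also have "\<dots> \<le> (\<Sum>x\<in>nodes j - mild_nodes j. card (entangled j x))"
    by (intro sum_mono) (auto simp: mild_nodes_def)
  also have "\<dots> \<le> (\<Sum>x\<in>nodes j. card (entangled j x))"
    by (intro sum_mono2) auto
  also have "\<dots> \<le> 3 * length (P j)"
    using sum_entangled[OF j] .
  finally have "25 * card (nodes j - mild_nodes j) \<le> 3 * length (P j)" .
  moreover have "card (nodes j) = card (mild_nodes j) + card (nodes j - mild_nodes j)"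
    using card_Int_Diff[of "nodes j" "mild_nodes j"] Int_absorb1[of "mild_nodes j" "nodes j"]
    by (simp add: mild_nodes_def)
  ultimately show ?thesis
    using distinct_card[OF distinct_path[OF j]] by linarith
qed

lemma card_mild_long_steps_ge:
  assumes j: "j \<in> I"
  shows "L * length (P j) \<le> 4 * card (mild_long_steps j)"
proof -
  define A where "A = pos j ` mild_nodes j"
  have mild: "mild_nodes j \<subseteq> nodes j"
    by (auto simp: mild_nodes_def)
  have inj: "inj_on (pos j) (mild_nodes j)"
    using inj_on_position mild by (rule inj_on_subset)
  have "A \<subseteq> {..<length (P j)}"
    using mild by (auto simp: A_def intro!: position_less)
  moreover have "7 * length (P j) \<le> 8 * card A"
    using card_mild_nodes_ge[OF j] by (simp add: A_def card_image inj)
  ultimately have "L * length (P j) \<le> 4 * card {(m, m') \<in> A \<times> A. m + L \<le> m' \<and> m' < m + 2 * L}"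
    (is "_ \<le> 4 * card ?G")
    using length_ge[OF j] by (rule card_gap_pairs_ge)
  moreover have "?G \<subseteq> map_prod (pos j) (pos j) ` mild_long_steps j"
    using mild j scales(1) by (force simp: A_def mild_long_steps_def long_step_def before_iff)
  then have "card ?G \<le> card (mild_long_steps j)"
    using finite_mild_long_steps surj_card_le by blast
  ultimately show ?thesis by linarith
qed

definition rungs_over :: "'i \<Rightarrow> (('a \<times> 'a) \<times> ('i \<times> 'i)) set" where
  "rungs_over j = (SIGMA q:mild_long_steps j. {i. corner (fst q) j i} \<times> {k. corner (snd q) j k})"

lemma card_rungs_over_ge:
  assumes j: "j \<in> I"
  shows "L * length (P j) * d\<^sup>2 \<le> 16 * card (rungs_over j)"
proof -
  have many: "d \<le> 2 * card {i. corner x j i}" if "x \<in> mild_nodes j" for x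
    using card_corners_ge[OF j, of x] that degree_ge by (auto simp: mild_nodes_def)
  have "L * length (P j) * d\<^sup>2 \<le> 4 * card (mild_long_steps j) * d\<^sup>2"
    using card_mild_long_steps_ge[OF j] by (rule mult_le_mono1)
  also have "\<dots> = 4 * (\<Sum>q\<in>mild_long_steps j. d * d)"
    by (simp add: power2_eq_square)
  also have "\<dots> \<le> 4 *
      (\<Sum>q\<in>mild_long_steps j. (2 * card {i. corner (fst q) j i}) * (2 * card {k. corner (snd q) j k}))"
    using many by (intro mult_le_mono2 sum_mono mult_le_mono) (auto simp: mild_long_steps_def)
  also have "\<dots> = 16 * card (rungs_over j)"
    using finite_mild_long_steps finite_corners
    by (simp add: rungs_over_def card_cartesian_product sum_distrib_left mult_ac)
  finally show ?thesis .
qed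

lemma card_long_rungs_ge: "total_length * L * d\<^sup>2 \<le> 16 * card long_rungs"
proof -
  have fin: "finite (rungs_over j)" for j
    unfolding rungs_over_def using finite_mild_long_steps finite_corners by auto
  have "total_length * L * d\<^sup>2 = (\<Sum>j\<in>I. L * length (P j) * d\<^sup>2)"
    by (simp add: total_length_def sum_distrib_left sum_distrib_right mult_ac)
  also have "\<dots> \<le> (\<Sum>j\<in>I. 16 * card (rungs_over j))"
    by (intro sum_mono card_rungs_over_ge)
  also have "\<dots> = 16 * card (SIGMA j:I. rungs_over j)"
    using finite_I fin by (simp add: sum_distrib_left)
  also have "card (SIGMA j:I. rungs_over j) \<le> card long_rungs"
  proof (rule card_inj_on_le[of "\<lambda>(j, (x, y), (i, k)). (i, x, j, y, k)"])
    show "(\<lambda>(j, (x, y), (i, k)). (i, x, j, y, k)) ` (SIGMA j:I. rungs_over j) \<subseteq> long_rungs"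
      by (auto simp: rungs_over_def long_rungs_def mild_long_steps_def corner_sym)
  qed (auto simp: inj_on_def finite_long_rungs)
  finally show ?thesis by simp
qed

lemma card_long_rungs_squared_le:
  "s * (card long_rungs)\<^sup>2 \<le> 3 * card I * total_length * (card long_rungs + 2 * card thin_diamonds)"
proof -
  obtain T where T: "finite T" "rung_cell ` long_rungs \<subseteq> T" "s * card T \<le> 3 * card I * total_length"
    using exists_small_cell_range by blast
  have "(card long_rungs)\<^sup>2 \<le> card T * card same_cell_pairs"
    unfolding same_cell_pairs_def using finite_long_rungs T(1,2) by (rule card_squared_le_fibre_product)
  also have "\<dots> \<le> card T * (card long_rungs + 2 * card thin_diamonds)"
    using card_same_cell_pairs_le by (rule mult_le_mono2)
  finally have "s * (card long_rungs)\<^sup>2 \<le> s * card T * (card long_rungs + 2 * card thin_diamonds)"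
    by (simp add: mult.assoc)
  also have "\<dots> \<le> 3 * card I * total_length * (card long_rungs + 2 * card thin_diamonds)"
    using T(3) by (rule mult_le_mono1)
  finally show ?thesis .
qed

lemma card_long_rungs_squared_le_thin_diamonds:
  assumes "96 * card I \<le> s * L * d\<^sup>2"
  shows "s * (card long_rungs)\<^sup>2 \<le> 12 * card I * total_length * card thin_diamonds"
proof -
  have "96 * (card I * total_length) \<le> s * (total_length * L * d\<^sup>2)"
    using mult_le_mono1[OF assms, of total_length] by (simp add: mult_ac)
  also have "\<dots> \<le> s * (16 * card long_rungs)"
    using card_long_rungs_ge by (rule mult_le_mono2)
  finally have "6 * (card I * total_length) * card long_rungs \<le> s * card long_rungs * card long_rungs"
    by (intro mult_le_mono1) simp
  then have "2 * (3 * card I * total_length * card long_rungs) \<le> s * (card long_rungs)\<^sup>2"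
    by (simp add: power2_eq_square mult_ac)
  then show ?thesis
    using card_long_rungs_squared_le by (simp add: distrib_left)
qed

lemma scaled_degree_length_inequality:
  assumes "I \<noteq> {}" "96 * card I \<le> s * L * d\<^sup>2"
  shows "L ^ 3 * d ^ 4 \<le> 3072 * card I * (12 * d * L\<^sup>2 + s * card I)"
proof -
  let ?R = "card long_rungs" and ?p = "card I" and ?M = "total_length"
  obtain i where "i \<in> I"
    using assms(1) by blast
  then have "0 < ?M"
    unfolding total_length_def using finite_I length_ge scales(1) by (intro sum_pos2[of _ i]) fastforce+
  have "s * (L * ?R\<^sup>2) \<le> 12 * ?p * ?M * (L * card thin_diamonds)"
    using mult_le_mono2[OF card_long_rungs_squared_le_thin_diamonds[OF assms(2)], of L]
    by (simp add: mult_ac)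
  also have "\<dots> \<le> 12 * ?p * ?M * (12 * d * s * L\<^sup>2 * ?M + s\<^sup>2 * ?p * ?M)"
    using card_thin_diamonds_le by (rule mult_le_mono2)
  also have "\<dots> = s * (12 * ?p * ?M\<^sup>2 * (12 * d * L\<^sup>2 + s * ?p))"
    by (simp add: algebra_simps power2_eq_square)
  finally have upper: "L * ?R\<^sup>2 \<le> 12 * ?p * ?M\<^sup>2 * (12 * d * L\<^sup>2 + s * ?p)"
    using scales(2) by simp
  have "?M\<^sup>2 * (L ^ 3 * d ^ 4) = L * (?M * L * d\<^sup>2)\<^sup>2"
    by (simp add: power2_eq_square power3_eq_cube power4_eq_xxxx mult_ac)
  also have "\<dots> \<le> L * (16 * ?R)\<^sup>2"
    using card_long_rungs_ge by (intro mult_le_mono2 power_mono) auto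
  also have "\<dots> = 256 * (L * ?R\<^sup>2)"
    by (simp add: power_mult_distrib)
  also have "\<dots> \<le> 256 * (12 * ?p * ?M\<^sup>2 * (12 * d * L\<^sup>2 + s * ?p))"
    using upper by (rule mult_le_mono2)
  finally have "?M\<^sup>2 * (L ^ 3 * d ^ 4) \<le> ?M\<^sup>2 * (3072 * ?p * (12 * d * L\<^sup>2 + s * ?p))"
    by (simp add: mult_ac)
  then show ?thesis
    using \<open>0 < ?M\<close> by simp
qed

end

section \<open>Passing to a dense subfamily\<close>

lemma exists_balanced_labels:
  fixes S :: "'a \<Rightarrow> 'i set" and d :: nat
  assumes "\<And>x. finite (S x)" "0 < d" "\<And>x. S x \<noteq> {} \<Longrightarrow> d \<le> card (S x)"
  shows "\<exists>label::'a \<Rightarrow> 'i \<Rightarrow> nat. \<forall>x. \<forall>i\<in>S x. card {j\<in>S x. label x j = label x i} \<in> {d..2 * d}"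
proof (rule choice, rule allI)
  fix x
  show "\<exists>f::'i \<Rightarrow> nat. \<forall>i\<in>S x. card {j\<in>S x. f j = f i} \<in> {d..2 * d}"
    using exists_balanced_partition[OF assms(1,2), of x] assms(3)[of x] by (cases "S x = {}") auto
qed

context bridge_free_family
begin

lemma earlier_meetings_filter_subset:
  assumes "J \<subseteq> I" "T \<subseteq> T'"
  shows "bridge_free_family.earlier_meetings J (\<lambda>i. filter (Q i) (P i)) T i x \<subseteq> earlier_meetings T' i x"
proof -
  interpret F: bridge_free_family J "\<lambda>i. filter (Q i) (P i)"
    using assms(1) by (rule bridge_free_filter)
  show ?thesis
    using assms unfolding F.earlier_meetings_def earlier_meetings_def by (auto dest: precedes_filterD)
qed

lemma sum_entangled_filter_le:
  fixes Q :: "'i \<Rightarrow> 'a \<Rightarrow> bool"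
  assumes J: "J \<subseteq> I" "i \<in> J" and few: "\<And>x. x \<in> T \<Longrightarrow> card (earlier_meetings T i x) \<le> 1"
  defines "P' \<equiv> \<lambda>i. filter (Q i) (P i)"
  assumes sub: "set (P' i) \<subseteq> T"
  shows "(\<Sum>x\<in>set (P' i). card (bridge_free_family.entangled J P' i x)) \<le> 3 * length (P' i)"
proof -
  interpret F: bridge_free_family J P'
    unfolding P'_def using J(1) by (rule bridge_free_filter)
  show ?thesis
  proof (rule F.sum_entangled_le[OF J(2)])
    fix x assume x: "x \<in> set (P' i)"
    have "F.earlier_meetings (set (P' i)) i x \<subseteq> earlier_meetings T i x"
      using earlier_meetings_filter_subset[OF J(1) sub] unfolding P'_def .
    then have "card (F.earlier_meetings (set (P' i)) i x) \<le> card (earlier_meetings T i x)"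
      by (rule card_mono[OF finite_earlier_meetings])
    then show "card (F.earlier_meetings (set (P' i)) i x) \<le> 1"
      using few[of x] sub x by fastforce
  qed
qed

lemma exists_dense_disentangled_subfamily:
  assumes V: "finite V" "(\<Union>i\<in>I. nodes i) \<subseteq> V"
    and size: "2 * (card V * d + card I * m) < (\<Sum>i\<in>I. length (P i))"
  shows "\<exists>J (P' :: 'i \<Rightarrow> 'a list). J \<subseteq> I \<and> J \<noteq> {} \<and> bridge_free_family J P' \<and>
    (\<forall>i\<in>J. m \<le> length (P' i) \<and> (\<forall>x\<in>set (P' i). d \<le> card {j\<in>J. x \<in> set (P' j)}) \<and>
      (\<Sum>x\<in>set (P' i). card (bridge_free_family.entangled J P' i x)) \<le> 3 * length (P' i))"
proof -
  obtain T where T: "\<And>i. i \<in> I \<Longrightarrow> T i \<subseteq> nodes i \<and> length (P i) \<le> 2 * card (T i) \<and>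
      (\<forall>x\<in>T i. card (earlier_meetings (T i) i x) \<le> 1)"
    using exists_half_with_few_earlier_meetings by metis
  then have TI: "T i \<subseteq> nodes i" if "i \<in> I" for i
    using that by blast
  have "(\<Sum>i\<in>I. length (P i)) \<le> (\<Sum>i\<in>I. 2 * card (T i))"
    using T by (intro sum_mono) auto
  moreover have "{x\<in>V. x \<in> T i} = T i" if "i \<in> I" for i
    using TI V(2) that by blast
  ultimately have "card V * d + card I * m < (\<Sum>i\<in>I. card {x\<in>V. x \<in> T i})"
    using size by (simp flip: sum_distrib_left)
  from exists_dense_subgraph[OF finite_I V(1) this]
  obtain J W where J: "J \<subseteq> I" "J \<noteq> {}" and long: "\<forall>i\<in>J. m \<le> card {x\<in>W. x \<in> T i}"
    and heavy: "\<forall>x\<in>W. d \<le> card {i\<in>J. x \<in> T i}"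
    by blast
  define P' where "P' i = filter (\<lambda>x. x \<in> T i \<inter> W) (P i)" for i
  have P': "set (P' i) = {x\<in>W. x \<in> T i}" if "i \<in> J" for i
    using TI[of i] J(1) that by (auto simp: P'_def)
  have free: "bridge_free_family J P'"
    unfolding P'_def using J(1) by (rule bridge_free_filter)
  have "(\<Sum>x\<in>set (P' i). card (bridge_free_family.entangled J P' i x)) \<le> 3 * length (P' i)"
    if "i \<in> J" for i
    unfolding P'_def by (rule sum_entangled_filter_le[OF J(1) that, of "T i"]) (use T J(1) that in auto)
  moreover have "m \<le> length (P' i)" if "i \<in> J" for i
    using long P' that distinct_card[OF bridge_free_family.distinct_path[OF free that]] by auto
  moreover have "d \<le> card {j\<in>J. x \<in> set (P' j)}" if "i \<in> J" "x \<in> set (P' i)" for i x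
  proof -
    have "{j\<in>J. x \<in> set (P' j)} = {j\<in>J. x \<in> T j}"
      using that P' by auto
    then show ?thesis
      using heavy that P' by auto
  qed
  ultimately show ?thesis
    using J free by blast
qed

lemma degree_length_inequality:
  assumes V: "finite V" "(\<Union>i\<in>I. nodes i) \<subseteq> V"
    and size: "2 * (card V * d + card I * (4 * L)) < (\<Sum>i\<in>I. length (P i))"
    and scales: "48 \<le> d" "0 < L" "0 < s" "s \<le> 4 * L" and enough: "96 * card I \<le> s * L * d\<^sup>2"
  shows "L ^ 3 * d ^ 4 \<le> 3072 * card I * (12 * d * L\<^sup>2 + s * card I)"
proof -
  obtain J and P' :: "'i \<Rightarrow> 'a list" where J: "J \<subseteq> I" "J \<noteq> {}" and free: "bridge_free_family J P'"
    and dense: "\<forall>i\<in>J. 4 * L \<le> length (P' i) \<and> (\<forall>x\<in>set (P' i). d \<le> card {j\<in>J. x \<in> set (P' j)}) \<and>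
      (\<Sum>x\<in>set (P' i). card (bridge_free_family.entangled J P' i x)) \<le> 3 * length (P' i)"
    using exists_dense_disentangled_subfamily[OF V size] by (elim exE conjE) (rule that)
  interpret F: bridge_free_family J P'
    by (rule free)
  have "\<exists>label::'a \<Rightarrow> 'i \<Rightarrow> nat. \<forall>x. \<forall>i\<in>{j\<in>J. x \<in> F.nodes j}.
      card {j\<in>{j\<in>J. x \<in> F.nodes j}. label x j = label x i} \<in> {d..2 * d}"
    using F.finite_I dense scales(1) by (intro exists_balanced_labels) auto
  then obtain label :: "'a \<Rightarrow> 'i \<Rightarrow> nat" where
    label: "\<And>x i. \<lbrakk>i \<in> J; x \<in> F.nodes i\<rbrakk>
      \<Longrightarrow> card {j\<in>J. x \<in> F.nodes j \<and> label x j = label x i} \<in> {d..2 * d}"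
    by (auto simp: conj_assoc)
  interpret G: scaled_dense_family J P' label d L s
  proof
    show "card {j\<in>J. x \<in> F.nodes j \<and> label x j = label x i} \<in> {d..2 * d}"
      if "i \<in> J" "x \<in> F.nodes i" for i x
      using label that .
  qed (use dense scales in auto)
  have le: "card J \<le> card I"
    using J(1) finite_I by (rule card_mono[rotated])
  have "L ^ 3 * d ^ 4 \<le> 3072 * card J * (12 * d * L\<^sup>2 + s * card J)"
    using J(2) enough le by (intro G.scaled_degree_length_inequality) auto
  also have "\<dots> \<le> 3072 * card I * (12 * d * L\<^sup>2 + s * card I)"
    using le by (intro mult_le_mono add_le_mono) auto
  finally show ?thesis .
qed

end

section \<open>Optimising the scale\<close>

lemma regime_of_unit_scale:
  fixes d L p :: nat
  assumes "0 < d" "0 < L" "96 * p \<le> L * d\<^sup>2" and ineq: "L ^ 3 * d ^ 4 \<le> 3072 * p * (12 * d * L\<^sup>2 + p)"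
  shows "L * d ^ 3 \<le> 55296 * p"
proof -
  have "3 * (3072 * p\<^sup>2) = (96 * p)\<^sup>2"
    by (simp add: power_mult_distrib)
  also have "\<dots> \<le> (L * d\<^sup>2)\<^sup>2"
    using assms(3) by (rule power_mono) simp
  also have "\<dots> = 1 * (L\<^sup>2 * d ^ 4)"
    by (simp add: power_mult_distrib flip: power_mult)
  also have "\<dots> \<le> L * (L\<^sup>2 * d ^ 4)"
    using assms(2) by (intro mult_le_mono1) simp
  also have "\<dots> = L ^ 3 * d ^ 4"
    by (simp add: power2_eq_square power3_eq_cube)
  finally have "2 * (L ^ 3 * d ^ 4) \<le> 110592 * p * d * L\<^sup>2"
    using ineq by (simp add: algebra_simps power2_eq_square)
  then have "(d * L\<^sup>2) * (L * d ^ 3) \<le> (d * L\<^sup>2) * (55296 * p)"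
    by (simp add: power2_eq_square power3_eq_cube power4_eq_xxxx mult_ac)
  then show ?thesis
    using assms(1,2) by simp
qed

lemma regimes_of_coarse_scale:
  fixes d L p s :: nat
  assumes "0 < d" "0 < L" and s: "s * (L * d\<^sup>2) \<le> 192 * p"
    and ineq: "L ^ 3 * d ^ 4 \<le> 3072 * p * (12 * d * L\<^sup>2 + s * p)"
  shows "L * d ^ 3 \<le> 73728 * p \<or> L ^ 4 * d ^ 6 \<le> 1179648 * p ^ 3"
proof -
  have "L ^ 4 * d ^ 6 = L ^ 3 * d ^ 4 * (L * d\<^sup>2)"
    by (simp add: eval_nat_numeral)
  also have "\<dots> \<le> 3072 * p * (12 * d * L\<^sup>2 + s * p) * (L * d\<^sup>2)"
    using ineq by (rule mult_le_mono1)
  also have "\<dots> = 36864 * p * (L ^ 3 * d ^ 3) + 3072 * p\<^sup>2 * (s * (L * d\<^sup>2))"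
    by (simp add: algebra_simps power2_eq_square power3_eq_cube)
  also have "\<dots> \<le> 36864 * p * (L ^ 3 * d ^ 3) + 3072 * p\<^sup>2 * (192 * p)"
    using s by (intro add_left_mono mult_le_mono2)
  also have "\<dots> = 36864 * p * (L ^ 3 * d ^ 3) + 589824 * p ^ 3"
    by (simp add: power2_eq_square power3_eq_cube)
  finally consider "L ^ 4 * d ^ 6 \<le> 2 * (36864 * p * (L ^ 3 * d ^ 3))"
    | "L ^ 4 * d ^ 6 \<le> 2 * (589824 * p ^ 3)"
    by linarith
  then show ?thesis
  proof cases
    case 1
    moreover have "L ^ 4 * d ^ 6 = (L ^ 3 * d ^ 3) * (L * d ^ 3)"
      by (simp add: eval_nat_numeral)
    ultimately have "(L ^ 3 * d ^ 3) * (L * d ^ 3) \<le> (L ^ 3 * d ^ 3) * (73728 * p)"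
      by (simp add: mult_ac)
    then show ?thesis
      using assms(1,2) by simp
  qed simp
qed

lemma regime_of_short_paths:
  fixes d L p :: nat
  assumes "0 < L" "4 * L * (L * d\<^sup>2) \<le> 96 * p"
  shows "L ^ 4 * d ^ 6 \<le> 13824 * p ^ 3"
proof -
  have "1 * (L ^ 4 * d ^ 6) \<le> L\<^sup>2 * (L ^ 4 * d ^ 6)"
    using assms(1) by (intro mult_le_mono1) (simp add: Suc_le_eq)
  also have "\<dots> = ((L * d)\<^sup>2) ^ 3"
    by (simp add: power_mult_distrib flip: power_mult power_add mult.assoc)
  also have "\<dots> \<le> (24 * p) ^ 3"
    using assms(2) by (intro power_mono) (simp_all add: power2_eq_square mult_ac)
  finally show ?thesis
    by (simp add: power_mult_distrib)
qed

text \<open>The scale \<open>s\<close> is chosen as small as the hypothesis of \<open>ineq\<close> permits.\<close>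

lemma degree_length_regimes:
  fixes d L p :: nat
  assumes pos: "0 < d" "0 < L" "0 < p"
    and ineq: "\<And>s. \<lbrakk>0 < s; s \<le> 4 * L; 96 * p \<le> s * L * d\<^sup>2\<rbrakk>
      \<Longrightarrow> L ^ 3 * d ^ 4 \<le> 3072 * p * (12 * d * L\<^sup>2 + s * p)"
  shows "L * d ^ 3 \<le> 73728 * p \<or> L ^ 4 * d ^ 6 \<le> 1179648 * p ^ 3"
proof (cases "96 * p \<le> L * d\<^sup>2")
  case True
  have "L * d ^ 3 \<le> 55296 * p"
    using ineq[of 1] pos True by (intro regime_of_unit_scale) auto
  then show ?thesis by linarith
next
  case False
  define s where "s = 96 * p div (L * d\<^sup>2) + 1"
  have "0 < L * d\<^sup>2"
    using pos by simp
  then have "96 * p < s * (L * d\<^sup>2)"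
    using dividend_less_div_times[of "L * d\<^sup>2" "96 * p"] by (simp add: s_def algebra_simps)
  then have enough: "96 * p \<le> s * L * d\<^sup>2"
    by (simp add: mult.assoc)
  have floor: "(s - 1) * (L * d\<^sup>2) \<le> 96 * p"
    unfolding s_def by (simp only: add_diff_cancel_right' div_times_less_eq_dividend)
  show ?thesis
  proof (cases "s \<le> 4 * L")
    case True
    have "s * (L * d\<^sup>2) = (s - 1) * (L * d\<^sup>2) + L * d\<^sup>2"
      by (simp add: s_def)
    then have "s * (L * d\<^sup>2) \<le> 192 * p"
      using floor False by linarith
    moreover have "L ^ 3 * d ^ 4 \<le> 3072 * p * (12 * d * L\<^sup>2 + s * p)"
      using ineq[OF _ True enough] by (simp add: s_def)
    ultimately show ?thesis
      by (rule regimes_of_coarse_scale[OF pos(1,2)])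
  next
    case False
    then have "4 * L * (L * d\<^sup>2) \<le> (s - 1) * (L * d\<^sup>2)"
      by (intro mult_le_mono1) simp
    then have "L ^ 4 * d ^ 6 \<le> 13824 * p ^ 3"
      using floor by (intro regime_of_short_paths[OF pos(2)]) linarith
    then show ?thesis by linarith
  qed
qed

lemma half_quotient_le_div:
  assumes "0 < m div k"
  shows "real m / (2 * real k) \<le> real (m div k)"
proof -
  have "0 < k"
    using assms by (metis bot_nat_0.not_eq_extremum div_by_0)
  have "k * 1 \<le> k * (m div k)"
    using assms by (intro mult_le_mono2) simp
  moreover have "m < k * (m div k) + k"
    using \<open>0 < k\<close> by (metis dividend_less_times_div add.commute)
  ultimately have "m \<le> 2 * k * (m div k)"
    by linarith
  then have "real m \<le> real (2 * k * (m div k))"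
    by (simp only: of_nat_le_iff)
  then show ?thesis
    using \<open>0 < k\<close> by (simp add: field_simps)
qed

lemma powr_interpolation_le:
  fixes n p :: real
  assumes "0 < n" "0 < p"
  shows "n powr (3/5) * p powr (7/10) \<le> n powr (5/8) * p powr (11/16) + p"
proof (cases "p \<le> n\<^sup>2")
  case True
  have "p powr (1/80) \<le> (n\<^sup>2) powr (1/80)"
    using True assms by (intro powr_mono2) auto
  also have "(n\<^sup>2) powr (1/80) = n powr (1/40)"
    using assms by (simp add: powr_powr flip: powr_numeral)
  finally have "p powr (11/16) * p powr (1/80) \<le> p powr (11/16) * n powr (1/40)"
    by (rule mult_left_mono) simp
  moreover have "p powr (7/10) = p powr (11/16) * p powr (1/80)"
    by (simp flip: powr_add)
  ultimately have "n powr (3/5) * p powr (7/10) \<le> n powr (3/5) * (p powr (11/16) * n powr (1/40))"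
    by (intro mult_left_mono) auto
  also have "\<dots> = n powr (5/8) * p powr (11/16)"
    by (simp add: mult.left_commute flip: powr_add)
  finally show ?thesis
    using assms by linarith
next
  case False
  then have "(n\<^sup>2) powr (3/10) \<le> p powr (3/10)"
    using assms by (intro powr_mono2) auto
  moreover have "(n\<^sup>2) powr (3/10) = n powr (3/5)"
    using assms by (simp add: powr_powr flip: powr_numeral)
  ultimately have "n powr (3/5) * p powr (7/10) \<le> p powr (3/10) * p powr (7/10)"
    by (intro mult_right_mono) auto
  also have "\<dots> = p"
    using assms by (simp flip: powr_add)
  finally show ?thesis
    by (simp add: add_increasing)
qed

lemma size_le_of_first_regime:
  fixes m n p d L :: real
  assumes np: "0 < n" "0 < p" and m: "0 \<le> m" "m / (16 * n) \<le> d" "m / (64 * p) \<le> L"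
    and regime: "L * d ^ 3 \<le> 73728 * p"
  shows "m \<le> 1000 * (n powr (3/4) * p powr (1/2))"
proof -
  have "(m / (64 * p)) * (m / (16 * n)) ^ 3 \<le> L * d ^ 3"
    using m np by (intro mult_mono power_mono order.trans[OF _ m(3)]) auto
  also note regime
  finally have "m ^ 4 \<le> 64 * 16 ^ 3 * 73728 * (n ^ 3 * p ^ 2)"
    using np by (simp add: field_simps power2_eq_square power3_eq_cube power4_eq_xxxx)
  also have "\<dots> \<le> 1000 ^ 4 * (n ^ 3 * p ^ 2)"
    using np by (intro mult_right_mono) auto
  also have "\<dots> = (1000 * (n powr (3/4) * p powr (1/2))) ^ 4"
    using np by (simp add: power_mult_distrib powr_power)
  finally show ?thesis
    by (rule power_le_imp_le_base[of _ 3, simplified]) auto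
qed

lemma size_le_of_second_regime:
  fixes m n p d L :: real
  assumes np: "0 < n" "0 < p" and m: "0 \<le> m" "m / (16 * n) \<le> d" "m / (64 * p) \<le> L"
    and regime: "L ^ 4 * d ^ 6 \<le> 1179648 * p ^ 3"
  shows "m \<le> 1000 * (n powr (3/5) * p powr (7/10))"
proof -
  have "m ^ 10 / (64 ^ 4 * 16 ^ 6 * (p ^ 4 * n ^ 6)) = (m / (64 * p)) ^ 4 * (m / (16 * n)) ^ 6"
    by (simp add: power_divide power_mult_distrib flip: power_add)
  also have "\<dots> \<le> L ^ 4 * d ^ 6"
    using m np by (intro mult_mono power_mono zero_le_power order.trans[OF _ m(3)]) auto
  also note regime
  finally have "m ^ 10 \<le> 1179648 * p ^ 3 * (64 ^ 4 * 16 ^ 6 * (p ^ 4 * n ^ 6))"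
    using np
    by (simp only: pos_divide_le_eq zero_less_mult_iff zero_less_power zero_less_numeral simp_thms)
  also have "\<dots> = (1179648 * 64 ^ 4 * 16 ^ 6) * (n ^ 6 * p ^ 7)"
    by (simp add: mult_ac flip: power_add)
  also have "\<dots> \<le> 1000 ^ 10 * (n ^ 6 * p ^ 7)"
    using np by (intro mult_right_mono) auto
  also have "\<dots> = (1000 * (n powr (3/5) * p powr (7/10))) ^ 10"
    using np by (simp add: power_mult_distrib powr_power)
  finally show ?thesis
    by (rule power_le_imp_le_base[of _ 9, simplified]) auto
qed

section \<open>Path systems of bridge girth more than 4\<close>

lemma no_bridge_of_girth:
  assumes "enat k < bridge_girth Ps" "b \<le> k"
  shows "\<not> has_bridge Ps b"
proof
  assume b: "has_bridge Ps b"
  then have "bridge_girth Ps = enat (LEAST b. has_bridge Ps b)"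
    unfolding bridge_girth_def by auto
  moreover have "(LEAST b. has_bridge Ps b) \<le> b"
    using b by (rule Least_le)
  ultimately show False
    using assms by (simp flip: enat_ord_simps)
qed

lemma has_bridgeI:
  assumes "length v = b" "length f = b" "distinct v" "distinct f" "0 < b"
    "\<And>i. i < b \<Longrightarrow> f ! i < length Ps"
    "\<And>i. i + 1 < b \<Longrightarrow> precedes (Ps ! (f ! i)) (v ! i) (v ! (i + 1))"
    "precedes (Ps ! (f ! (b - 1))) (v ! 0) (v ! (b - 1))"
  shows "has_bridge Ps b"
  unfolding has_bridge_def using assms
  by (intro conjI exI[of _ "(!) v"] exI[of _ "(!) f"]) (auto intro: inj_on_nth)

lemma no_2_bridge_of_girth:
  assumes ps: "path_system V Ps" and girth: "enat k < bridge_girth Ps" "2 \<le> k"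
    and mem: "i < length Ps" "j < length Ps" and prec: "precedes (Ps ! i) x y" "precedes (Ps ! j) x y"
  shows "i = j"
proof (rule ccontr)
  assume "i \<noteq> j"
  have "distinct (Ps ! i)"
    using ps mem(1) by (auto simp: path_system_def)
  then have "x \<noteq> y"
    using prec(1) by (auto simp: precedes_iff_position)
  then have "has_bridge Ps 2"
    using mem prec \<open>i \<noteq> j\<close>
    by (intro has_bridgeI[of "[x, y]" _ "[i, j]"]) (auto simp: less_Suc_eq numeral_2_eq_2)
  then show False
    using no_bridge_of_girth[OF girth] by simp
qed

lemma bridge_free_family_of_girth:
  assumes ps: "path_system V Ps" and girth: "enat 4 < bridge_girth Ps"
  shows "bridge_free_family {..<length Ps} ((!) Ps)"
proof
  have dist: "distinct (Ps ! i)" if "i < length Ps" for i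
    using ps that unfolding path_system_def by auto
  then show "distinct (Ps ! i)" if "i \<in> {..<length Ps}" for i
    using that by simp
  have ne: "x \<noteq> y" if "i < length Ps" "precedes (Ps ! i) x y" for i x y
    using that dist by (auto simp: precedes_iff_position)
  note no_bridge = no_bridge_of_girth[OF girth]
  have no_2_bridge: "i = j" if "i < length Ps" "j < length Ps"
    "precedes (Ps ! i) x y" "precedes (Ps ! j) x y" for i j x y
    using no_2_bridge_of_girth[OF ps girth _ that] by simp
  then show "i = j" if "i \<in> {..<length Ps}" "j \<in> {..<length Ps}"
    "precedes (Ps ! i) x y" "precedes (Ps ! j) x y" for i j x y
    using that by auto
  show "\<not> distinct [i, j, k]"
    if mem: "i \<in> {..<length Ps}" "j \<in> {..<length Ps}" "k \<in> {..<length Ps}"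
      and prec: "precedes (Ps ! i) x y" "precedes (Ps ! j) y z" "precedes (Ps ! k) x z" for i j k x y z
  proof
    assume "distinct [i, j, k]"
    then have "has_bridge Ps 3"
      using mem prec ne[of i x y] ne[of j y z] ne[of k x z]
      by (intro has_bridgeI[of "[x, y, z]" _ "[i, j, k]"]) (auto simp: less_Suc_eq numeral_3_eq_3)
    then show False
      using no_bridge[of 3] by simp
  qed
  show "\<not> distinct [i, j, k, l]"
    if mem: "i \<in> {..<length Ps}" "j \<in> {..<length Ps}" "k \<in> {..<length Ps}" "l \<in> {..<length Ps}"
      and prec: "precedes (Ps ! i) x y" "precedes (Ps ! j) y z" "precedes (Ps ! k) z w"
        "precedes (Ps ! l) x w"
    for i j k l x y z w
  proof
    assume paths: "distinct [i, j, k, l]"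
    have "x \<noteq> z" "y \<noteq> w"
      using no_2_bridge[of k l x w] no_2_bridge[of i l x w] mem prec paths by auto
    then have "has_bridge Ps 4"
      using mem prec paths ne[of i x y] ne[of j y z] ne[of k z w] ne[of l x w]
      by (intro has_bridgeI[of "[x, y, z, w]" _ "[i, j, k, l]"])
        (auto simp: less_Suc_eq eval_nat_numeral)
    then show False
      using no_bridge[of 4] by simp
  qed
qed simp

lemma ps_size_eq_sum: "ps_size Ps = (\<Sum>i<length Ps. length (Ps ! i))"
  unfolding ps_size_def by (simp add: sum_list_sum_nth atLeast0LessThan)

lemma ps_size_le:
  assumes "path_system V Ps"
  shows "ps_size Ps \<le> length Ps * card V"
proof -
  have "length (Ps ! i) \<le> card V" if "i < length Ps" for i
    using assms that distinct_card[of "Ps ! i"] card_mono[of V "set (Ps ! i)"]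
    by (auto simp: path_system_def)
  then show ?thesis
    using sum_bounded_above[of "{..<length Ps}" "\<lambda>i. length (Ps ! i)" "card V"]
    by (simp add: ps_size_eq_sum)
qed

lemma bridge_girth_empty_paths: "bridge_girth (replicate p ([] :: 'a list)) = \<infinity>"
proof -
  have "\<not> has_bridge (replicate p ([] :: 'a list)) b" for b
    unfolding has_bridge_def precedes_def by (auto dest!: spec[of _ "b - 1"])
  then show ?thesis
    by (simp add: bridge_girth_def)
qed

lemma beta_attained:
  "\<exists>V Ps. path_system (V::nat set) Ps \<and> card V = n \<and> length Ps = p \<and> enat k < bridge_girth Ps \<and>
    beta n p k = ps_size Ps"
proof -
  let ?S = "{ps_size Ps | (V::nat set) Ps. path_system V Ps \<and> card V = n \<and> length Ps = p \<and>
    bridge_girth Ps > enat k}"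
  have "?S \<subseteq> {..p * n}"
    using ps_size_le by auto
  then have "finite ?S"
    using finite_subset by blast
  moreover let ?empty = "replicate p ([] :: nat list)"
  have "path_system {..<n} ?empty \<and> card {..<n} = n \<and> length ?empty = p \<and> bridge_girth ?empty > enat k"
    by (simp add: path_system_def bridge_girth_empty_paths)
  then have "?S \<noteq> {}"
    by blast
  ultimately have "beta n p k \<in> ?S"
    unfolding beta_def by (rule Max_in)
  then show ?thesis by blast
qed

lemma dense_path_system_regimes:
  assumes ps: "path_system V Ps" and girth: "enat 4 < bridge_girth Ps"
  defines "d \<equiv> ps_size Ps div (8 * card V)" and "L \<equiv> ps_size Ps div (32 * length Ps)"
  assumes large: "48 \<le> d" "0 < L"
  shows "L * d ^ 3 \<le> 73728 * length Ps \<or> L ^ 4 * d ^ 6 \<le> 1179648 * length Ps ^ 3"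
proof -
  interpret bridge_free_family "{..<length Ps}" "(!) Ps"
    using ps girth by (rule bridge_free_family_of_girth)
  have pos: "0 < ps_size Ps" "0 < length Ps"
    using large(2) unfolding L_def by (auto intro: Nat.gr0I)
  have "8 * card V * d \<le> ps_size Ps" "32 * length Ps * L \<le> ps_size Ps"
    unfolding d_def L_def by (rule times_div_less_eq_dividend)+
  then have size: "2 * (card V * d + card {..<length Ps} * (4 * L)) < (\<Sum>i<length Ps. length (Ps ! i))"
    using pos(1) by (simp flip: ps_size_eq_sum)
  have "finite V" "(\<Union>i<length Ps. set (Ps ! i)) \<subseteq> V"
    using ps by (auto simp: path_system_def)
  then have "L ^ 3 * d ^ 4 \<le> 3072 * length Ps * (12 * d * L\<^sup>2 + s * length Ps)"
    if "0 < s" "s \<le> 4 * L" "96 * length Ps \<le> s * L * d\<^sup>2" for s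
    using degree_length_inequality[OF _ _ size large that(1,2)] that(3) by simp
  then show ?thesis
    using large pos(2) by (intro degree_length_regimes) auto
qed

lemma dense_ps_size_bound:
  assumes ps: "path_system V Ps" and girth: "enat 4 < bridge_girth Ps"
    and large: "48 \<le> ps_size Ps div (8 * card V)" "0 < ps_size Ps div (32 * length Ps)"
  defines "n \<equiv> real (card V)" and "p \<equiv> real (length Ps)"
  shows "real (ps_size Ps) \<le> 1000 * (n powr (3/4) * p powr (1/2)) \<or>
    real (ps_size Ps) \<le> 1000 * (n powr (3/5) * p powr (7/10))"
proof -
  let ?d = "ps_size Ps div (8 * card V)" and ?L = "ps_size Ps div (32 * length Ps)"
  have np: "0 < n" "0 < p"
    using large by (auto simp: n_def p_def intro: Nat.gr0I)
  have d_ge: "real (ps_size Ps) / (16 * n) \<le> real ?d" and L_ge: "real (ps_size Ps) / (64 * p) \<le> real ?L"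
    using half_quotient_le_div[of "ps_size Ps" "8 * card V"]
      half_quotient_le_div[of "ps_size Ps" "32 * length Ps"] large
    by (simp_all add: n_def p_def)
  have "real (?L * ?d ^ 3) \<le> real (73728 * length Ps) \<or>
      real (?L ^ 4 * ?d ^ 6) \<le> real (1179648 * length Ps ^ 3)"
    using dense_path_system_regimes[OF ps girth large] by (simp only: of_nat_le_iff)
  then show ?thesis
    using size_le_of_first_regime[OF np _ d_ge L_ge] size_le_of_second_regime[OF np _ d_ge L_ge]
    by (auto simp: p_def)
qed

lemma ps_size_bound:
  assumes ps: "path_system V Ps" and girth: "enat 4 < bridge_girth Ps"
    and nonempty: "0 < card V" "0 < length Ps"
  defines "n \<equiv> real (card V)" and "p \<equiv> real (length Ps)"
  shows "real (ps_size Ps)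
    \<le> 1000 * (n powr (3/4) * p powr (1/2) + n powr (5/8) * p powr (11/16) + n + p)"
proof -
  have np: "0 < n" "0 < p"
    using nonempty by (auto simp: n_def p_def)
  have terms: "0 \<le> n powr (3/4) * p powr (1/2)" "0 \<le> n powr (5/8) * p powr (11/16)"
    by auto
  consider "ps_size Ps div (8 * card V) < 48" | "ps_size Ps div (32 * length Ps) = 0"
    | "48 \<le> ps_size Ps div (8 * card V)" "0 < ps_size Ps div (32 * length Ps)"
    by linarith
  then have "real (ps_size Ps) \<le> 384 * n \<or> real (ps_size Ps) \<le> 32 * p \<or>
      real (ps_size Ps) \<le> 1000 * (n powr (3/4) * p powr (1/2)) \<or>
      real (ps_size Ps) \<le> 1000 * (n powr (3/5) * p powr (7/10))"
  proof cases
    case 1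
    then have "ps_size Ps < 48 * (8 * card V)"
      using nonempty(1) by (simp add: div_less_iff_less_mult)
    then show ?thesis
      unfolding n_def by linarith
  next
    case 2
    then have "ps_size Ps < 32 * length Ps"
      using nonempty(2) by (simp add: div_eq_0_iff)
    then show ?thesis
      unfolding p_def by linarith
  next
    case 3
    then show ?thesis
      using dense_ps_size_bound[OF ps girth] unfolding n_def p_def by blast
  qed
  then show ?thesis
    using powr_interpolation_le[OF np] terms np by argo
qed

theorem theorem3p4:
  shows "\<exists>C>0. \<forall>n p. n > 0 \<longrightarrow> p > 0 \<longrightarrow>
    real (beta n p 4) \<le> C * (real n powr (3/4) * real p powr (1/2)
       + real n powr (5/8) * real p powr (11/16) + real n + real p)"
proof (intro exI[of _ 1000] conjI allI impI)
  fix n p :: nat assume np: "n > 0" "p > 0"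
  obtain V :: "nat set" and Ps where "path_system V Ps" "card V = n" "length Ps = p"
    "enat 4 < bridge_girth Ps" "beta n p 4 = ps_size Ps"
    using beta_attained by blast
  then show "real (beta n p 4) \<le> 1000 * (real n powr (3/4) * real p powr (1/2)
       + real n powr (5/8) * real p powr (11/16) + real n + real p)"
    using ps_size_bound[of V Ps] np by simp
qed simp

end
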